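(* Let assumptions (A1)--(A6) (listed in the context) hold. Then there exists an evolution family $(U(t,s))_{0\le s\le t\le T}$ on $\ell_w^1$ such that the following statements are true. (a) For every $s\in[0,T)$ and every $\mathring{u}\in\ell_w^1$, the function $u(t)=U(t,s)\mathring{u}$, $t\in[s,T]$, is the unique classical solution in $\ell_w^1$ of $$u'(t)=G(t)u(t),\quad s<t\le T;\qquad u(s)=\mathring{u}.$$ (b) If $\mathring{u}\ge 0$, then the solution from (a) satisfies $u(t)\ge 0$ for $t\in[s,T]$; if, in addition, $\mathring{u}\neq 0$, then $u(t)\neq 0$ for $t\in[s,T]$. (c) If $$a_1(t)=0\quad\text{and}\quad \sum_{n=1}^{j-1} n\,b_{n,j}(t)=j\qquad\text{for all } j=2,3,\ldots \text{ and } t\in[0,T],$$ then the solution from (a) satisfies $M_1(u(t))=M_1(\mathring{u})$ for all $t\in[s,T]$ and all $\mathring{u}\in(\ell_w^1)_+$, where $M_1(f)=\sum_{n=1}^\infty n f_n$ for $f=(f_n)_{n=1}^\infty\in\ell_w^1$.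
   Context: Fix $T>0$, functions $a_n,b_{n,j}:[0,T]\to\mathbb{R}$ ($n,j\in\mathbb{N}=\{1,2,\ldots\}$) and a sequence $w=(w_n)_{n=1}^\infty$ of positive reals. Space: $\ell_w^1$ is the complex Banach lattice of complex sequences $f=(f_n)_{n=1}^\infty$ with $\|f\|_w=\sum_{n=1}^\infty w_n|f_n|<\infty$. Its positive cone is $(\ell_w^1)_+=\{f\in\ell_w^1: f_n\in\mathbb{R},\ f_n\ge 0\ \forall n\}$; $f\ge 0$ means $f\in(\ell_w^1)_+$. Assumptions: (A1) $a_n(t)\ge 0$ for all $t\in[0,T]$, $n\in\mathbb{N}$. (A2) $b_{n,j}(t)\ge 0$ for all $t\in[0,T]$, $n,j\in\mathbb{N}$, with $b_{n,j}(t)=0$ if $j\le n$. (A3) $w_n\ge n$ for all $n\in\mathbb{N}$. (A4) There is $\kappa\in(0,1)$ such that $\sum_{n=1}^{j-1}w_n b_{n,j}(t)\le\kappa w_j$ for all $t\in[0,T]$ and $j=2,3,\ldots$. There are constants $C_1\ge0$, $C_2\ge 0$ and $\sigma\in(0,1]$ such that: (A5) for all $n\in\mathbb{N}$ and $s,t,\tau\in[0,T]$, $\dfrac{|a_n(t)-a_n(s)|}{1+a_n(\tau)}\le C_1|t-s|^\sigma$; (A6) for all $j\in\{2,3,\ldots\}$ and $s,t,\tau\in[0,T]$, $\dfrac{1}{1+a_j(\tau)}\sum_{n=1}^{j-1}w_n\bigl|a_j(t)b_{n,j}(t)-a_j(s)b_{n,j}(s)\bigr|\le C_2 w_j|t-s|^\sigma$.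 Operators: for $t\in[0,T]$, in $\ell_w^1$, $A(t)f=(-a_n(t)f_n)_{n=1}^\infty$ with domain $D(A(t))=\{f\in\ell_w^1:(a_n(t)f_n)_{n=1}^\infty\in\ell_w^1\}$; $B(t)f=\bigl(\sum_{j=n+1}^\infty a_j(t)b_{n,j}(t)f_j\bigr)_{n=1}^\infty$ with $D(B(t))=D(A(t))$ (well defined by (A4)); $G(t)=A(t)+B(t)$ with $D(G(t))=D(A(t))$. Evolution family on a Banach space $X$: a family of bounded linear operators $(U(t,s))_{0\le s\le t\le T}$ on $X$ with $U(s,s)=I$, $U(t,r)U(r,s)=U(t,s)$ for $0\le s\le r\le t\le T$, and $(t,s)\mapsto U(t,s)$ strongly continuous for $0\le s\le t\le T$. Classical solution of $u'(t)=G(t)u(t)$, $t\in(s,T]$, $u(s)=\mathring{u}$, in $X$: a function $u\in C([s,T],X)\cap C^1((s,T],X)$ with $u(t)\in D(G(t))$ for all $t\in(s,T]$ satisfying the equation and the initial condition. *)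

theory Defs
  imports "HOL-Analysis.Analysis"
begin

text \<open>
  A sequence indexed by the positive integers is a function on \<^typ>\<open>nat\<close> whose entry at \<open>0\<close> is
  unused; the space below demands that entry to be \<open>0\<close>, so that two elements of the space are
  equal as functions iff they are equal as sequences. The weight depends on a variable, so the
  space is a carrier set rather than a type.
\<close>

type_synonym cseq = "nat \<Rightarrow> complex"

definition ell1 :: "(nat \<Rightarrow> real) \<Rightarrow> cseq set" where
  "ell1 w = {f. f 0 = 0 \<and> (\<lambda>n. w n * cmod (f n)) summable_on {1..}}"

definition ell1_norm :: "(nat \<Rightarrow> real) \<Rightarrow> cseq \<Rightarrow> real" where
  "ell1_norm w f = (\<Sum>\<^sub>\<infinity>n\<in>{1..}. w n * cmod (f n))"

definition ell1_dist :: "(nat \<Rightarrow> real) \<Rightarrow> cseq \<Rightarrow> cseq \<Rightarrow> real" where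
  "ell1_dist w f g = ell1_norm w (\<lambda>n. f n - g n)"

definition ell1_cone :: "(nat \<Rightarrow> real) \<Rightarrow> cseq set" where
  "ell1_cone w = {f \<in> ell1 w. \<forall>n\<ge>1. f n \<in> \<real> \<and> 0 \<le> Re (f n)}"

lemma ell1_diff:
  assumes w: "\<And>n. n \<ge> 1 \<Longrightarrow> 0 < w n" and f: "f \<in> ell1 w" and g: "g \<in> ell1 w"
  shows "(\<lambda>n. f n - g n) \<in> ell1 w"
proof -
  have "(\<lambda>n. w n * cmod (f n) + w n * cmod (g n)) summable_on {1..}"
    using f g by (intro summable_on_add) (auto simp: ell1_def)
  then have "(\<lambda>n. w n * cmod (f n - g n)) summable_on {1..}"
  proof (rule summable_on_comparison_test)
    fix n :: nat assume "n \<in> {1..}"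
    then have "0 < w n" using w by simp
    then show "w n * cmod (f n - g n) \<le> w n * cmod (f n) + w n * cmod (g n)"
      using norm_triangle_ineq4[of "f n" "g n"]
      by (metis distrib_left mult_left_mono less_imp_le)
    show "0 \<le> w n * cmod (f n - g n)" using \<open>0 < w n\<close> by simp
  qed
  then show ?thesis using f g by (simp add: ell1_def)
qed

text \<open>
  The topology below is only meaningful if \<open>ell1_dist\<close> is a metric, which is why this is proved
  here.
\<close>

lemma Metric_space_ell1:
  assumes w: "\<And>n. n \<ge> 1 \<Longrightarrow> 0 < w n"
  shows "Metric_space (ell1 w) (ell1_dist w)"
proof
  fix f g :: cseq
  show "0 \<le> ell1_dist w f g"
    unfolding ell1_dist_def ell1_norm_def
    using w by (intro infsum_nonneg) (simp add: less_imp_le)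
  show "ell1_dist w f g = ell1_dist w g f"
    by (simp add: ell1_dist_def ell1_norm_def norm_minus_commute)
next
  fix f g assume fg: "f \<in> ell1 w" "g \<in> ell1 w"
  have sm: "(\<lambda>n. w n * cmod (f n - g n)) summable_on {1..}"
    using ell1_diff[OF w fg] by (simp add: ell1_def)
  show "(ell1_dist w f g = 0) = (f = g)"
  proof
    assume 0: "ell1_dist w f g = 0"
    have "f n = g n" for n
    proof (cases "n = 0")
      case True
      then show ?thesis using fg by (simp add: ell1_def)
    next
      case False
      then have n: "n \<in> {1..}" by simp
      have "w n * cmod (f n - g n) = 0"
        by (rule nonneg_infsum_le_0D[OF _ sm _ n])
          (use 0 w in \<open>auto simp: ell1_dist_def ell1_norm_def less_imp_le\<close>)
      then show ?thesis using w[of n] n by simp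
    qed
    then show "f = g" by auto
  qed (simp add: ell1_dist_def ell1_norm_def)
next
  fix f g h assume fgh: "f \<in> ell1 w" "g \<in> ell1 w" "h \<in> ell1 w"
  have sm: "(\<lambda>n. w n * cmod (x n - y n)) summable_on {1..}"
    if "x \<in> ell1 w" "y \<in> ell1 w" for x y
    using ell1_diff[OF w that] by (simp add: ell1_def)
  have "ell1_dist w f h \<le> (\<Sum>\<^sub>\<infinity>n\<in>{1..}. w n * cmod (f n - g n) + w n * cmod (g n - h n))"
    unfolding ell1_dist_def ell1_norm_def
  proof (rule infsum_mono)
    fix n :: nat assume "n \<in> {1..}"
    then have "0 \<le> w n" using w by (simp add: less_imp_le)
    then show "w n * cmod (f n - h n) \<le> w n * cmod (f n - g n) + w n * cmod (g n - h n)"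
      using norm_triangle_ineq[of "f n - g n" "g n - h n"]
      by (metis distrib_left mult_left_mono diff_add_cancel add_diff_eq)
  qed (use sm fgh in \<open>auto intro!: summable_on_add\<close>)
  also have "\<dots> = ell1_dist w f g + ell1_dist w g h"
    unfolding ell1_dist_def ell1_norm_def using sm fgh by (intro infsum_add) auto
  finally show "ell1_dist w f h \<le> ell1_dist w f g + ell1_dist w g h" .
qed

definition ell1_top :: "(nat \<Rightarrow> real) \<Rightarrow> cseq topology" where
  "ell1_top w = Metric_space.mtopology (ell1 w) (ell1_dist w)"

definition ell1_bounded_linear :: "(nat \<Rightarrow> real) \<Rightarrow> (cseq \<Rightarrow> cseq) \<Rightarrow> bool" where
  "ell1_bounded_linear w L \<longleftrightarrow>
     (\<forall>f\<in>ell1 w. L f \<in> ell1 w) \<and>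
     (\<forall>f\<in>ell1 w. \<forall>g\<in>ell1 w. L (\<lambda>n. f n + g n) = (\<lambda>n. L f n + L g n)) \<and>
     (\<forall>c. \<forall>f\<in>ell1 w. L (\<lambda>n. c * f n) = (\<lambda>n. c * L f n)) \<and>
     (\<exists>K. \<forall>f\<in>ell1 w. ell1_norm w (L f) \<le> K * ell1_norm w f)"

text \<open>
  Only the values \<open>U t s\<close> with \<open>0 \<le> s \<le> t \<le> T\<close>, applied to elements of the space, matter.
\<close>

definition evolution_family ::
  "(nat \<Rightarrow> real) \<Rightarrow> real \<Rightarrow> (real \<Rightarrow> real \<Rightarrow> cseq \<Rightarrow> cseq) \<Rightarrow> bool" where
  "evolution_family w T U \<longleftrightarrow>
     (\<forall>s t. 0 \<le> s \<and> s \<le> t \<and> t \<le> T \<longrightarrow> ell1_bounded_linear w (U t s)) \<and>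
     (\<forall>s. 0 \<le> s \<and> s \<le> T \<longrightarrow> (\<forall>f\<in>ell1 w. U s s f = f)) \<and>
     (\<forall>s r t. 0 \<le> s \<and> s \<le> r \<and> r \<le> t \<and> t \<le> T \<longrightarrow>
        (\<forall>f\<in>ell1 w. U t r (U r s f) = U t s f)) \<and>
     (\<forall>f\<in>ell1 w. continuous_map (top_of_set {(t, s). 0 \<le> s \<and> s \<le> t \<and> t \<le> T}) (ell1_top w)
        (\<lambda>(t, s). U t s f))"

definition A_op :: "(nat \<Rightarrow> real \<Rightarrow> real) \<Rightarrow> real \<Rightarrow> cseq \<Rightarrow> cseq" where
  "A_op a t f = (\<lambda>n. - complex_of_real (a n t) * f n)"

definition A_dom :: "(nat \<Rightarrow> real) \<Rightarrow> (nat \<Rightarrow> real \<Rightarrow> real) \<Rightarrow> real \<Rightarrow> cseq set" where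
  "A_dom w a t = {f \<in> ell1 w. (\<lambda>n. complex_of_real (a n t) * f n) \<in> ell1 w}"

text \<open>
  The domain of \<open>B_op\<close> and \<open>G_op\<close> is also \<open>A_dom\<close>. On it the sums below converge absolutely, and
  \<open>B_op\<close> maps into \<open>ell1 w\<close>, as soon as \<open>b\<close> is nonnegative with \<open>(\<Sum>n=1..j-1. w n * b n j t) \<le> \<kappa> * w j\<close>.
\<close>

definition B_op ::
  "(nat \<Rightarrow> real \<Rightarrow> real) \<Rightarrow> (nat \<Rightarrow> nat \<Rightarrow> real \<Rightarrow> real) \<Rightarrow> real \<Rightarrow> cseq \<Rightarrow> cseq" where
  "B_op a b t f =
     (\<lambda>n. if n = 0 then 0 else \<Sum>\<^sub>\<infinity>j\<in>{n+1..}. complex_of_real (a j t * b n j t) * f j)"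

definition G_op ::
  "(nat \<Rightarrow> real \<Rightarrow> real) \<Rightarrow> (nat \<Rightarrow> nat \<Rightarrow> real \<Rightarrow> real) \<Rightarrow> real \<Rightarrow> cseq \<Rightarrow> cseq" where
  "G_op a b t f = (\<lambda>n. A_op a t f n + B_op a b t f n)"

definition ell1_has_deriv ::
  "(nat \<Rightarrow> real) \<Rightarrow> (real \<Rightarrow> cseq) \<Rightarrow> cseq \<Rightarrow> real \<Rightarrow> real set \<Rightarrow> bool" where
  "ell1_has_deriv w u v t S \<longleftrightarrow>
     limitin (ell1_top w) (\<lambda>r. (\<lambda>n. (u r n - u t n) / complex_of_real (r - t))) v (at t within S)"

text \<open>
  Classical solutions for a family of operators \<open>G t\<close> with domains \<open>D t\<close>. The derivative at the
  right end point \<open>T\<close> is one-sided.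
\<close>

definition classical_solution ::
  "(nat \<Rightarrow> real) \<Rightarrow> real \<Rightarrow> (real \<Rightarrow> cseq set) \<Rightarrow> (real \<Rightarrow> cseq \<Rightarrow> cseq) \<Rightarrow>
     real \<Rightarrow> cseq \<Rightarrow> (real \<Rightarrow> cseq) \<Rightarrow> bool" where
  "classical_solution w T D G s u0 u \<longleftrightarrow>
     continuous_map (top_of_set {s..T}) (ell1_top w) u \<and>
     (\<exists>u'. continuous_map (top_of_set {s<..T}) (ell1_top w) u' \<and>
        (\<forall>t\<in>{s<..T}. ell1_has_deriv w u (u' t) t {s<..T}) \<and>
        (\<forall>t\<in>{s<..T}. u t \<in> D t \<and> u' t = G t (u t))) \<and>
     u s = u0"

definition first_moment :: "cseq \<Rightarrow> complex" where
  "first_moment f = (\<Sum>\<^sub>\<infinity>n\<in>{1..}. of_nat n * f n)"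

end

theory Submission
  imports Defs
begin

text \<open>
  The system is upper triangular, so the solution that starts in a unit vector solves a finite
  system of ordinary differential equations, and it is nonnegative. The evolution family is the
  matrix with these solutions as columns. (A4) makes the weighted mass of a column nonincreasing,
  and everything else follows by dominated convergence once the columns satisfy the smoothing
  estimate \<open>\<Sum>k. w k * a k t * V t s k j \<le> K / (t - s) * w j\<close> with \<open>K\<close> independent of \<open>j\<close>.

  To prove that estimate, freeze the coefficients at the final time \<open>t\<close>. The dissipation rate of
  the frozen adjoint system decays like \<open>w k / ((1 - \<kappa>) * \<tau>)\<close> by a maximum principle; paired with
  the solution it changes at a rate controlled by (A5), (A6), with the integrable singularity
  \<open>(t - r) powr (\<sigma> - 1)\<close>. On a short window before \<open>t\<close> the resulting error is absorbed.

  Uniqueness holds because the generators are dissipative for complex sequences too, so the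
  distance of two solutions is nonincreasing.
\<close>

section \<open>Scalar and triangular linear differential equations\<close>

text \<open>The obstacle is uniformity in the column index. The rates \<open>a n t\<close> have no
  common bound, and (A5), (A6) measure a change of the generator relative to \<open>1 + a\<close>,
  hence in terms of the very quantity that is to be estimated. A single column, however, is a finite
  system with continuous coefficients, so the maximum of \<open>(r - s) * (load r s j + w j)\<close>
  over \<open>r\<close> is known to be finite before it is estimated; this is what makes absorption
  possible in place of a Gronwall argument with a singular kernel. The decay of this rate like
  \<open>1 / \<tau>\<close> is the smoothing estimate of an analytic semigroup in dual form,
  obtained by comparison functions instead of resolvents. The estimate then bounds the columns of
  \<open>a V\<close>, of the time derivative and of the difference quotients away from the initial
  time, which is the domination needed to pass from entries to sequences.\<close>

lemma mono_from_deriv_within: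
  fixes f f' :: "real \<Rightarrow> real"
  assumes "a \<le> b" and "continuous_on {a..b} f"
    and der: "\<And>x. x \<in> {a<..<b} \<Longrightarrow> (f has_real_derivative f' x) (at x within {a..b})"
    and nn: "\<And>x. x \<in> {a<..<b} \<Longrightarrow> 0 \<le> f' x"
  shows "f a \<le> f b"
proof (rule DERIV_nonneg_imp_increasing_open[OF assms(1) _ assms(2)])
  fix x assume x: "a < x" "x < b"
  then have "at x within {a..b} = at x"
    by (intro at_within_interior) (simp add: interior_atLeastAtMost_real)
  then show "\<exists>y. DERIV f x :> y \<and> y \<ge> 0"
    using der[of x] nn[of x] x by auto
qed

lemma exists_antiderivative:
  fixes g :: "real \<Rightarrow> real"
  assumes "continuous_on {c..d} g"
  obtains G where "G c = 0"
    "\<And>t. t \<in> {c..d} \<Longrightarrow> (G has_real_derivative g t) (at t within {c..d})"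
  by (rule that[of "\<lambda>x. integral {c..x} g"])
    (simp_all add: integral_has_real_derivative[OF assms])

text \<open>The integrating factor \<open>exp (A t)\<close>, with \<open>A\<close> an antiderivative
  of \<open>\<alpha>\<close>, turns the inequality into monotonicity. This is the comparison
  principle for all the differential systems below: it is applied to one component at a time, once
  the coupling terms have a known sign or bound.\<close>

lemma linear_differential_inequality_nonneg:
  fixes y y' \<alpha> :: "real \<Rightarrow> real"
  assumes der: "\<And>t. t \<in> {c..d} \<Longrightarrow> (y has_real_derivative y' t) (at t within {c..d})"
    and \<alpha>: "continuous_on {c..d} \<alpha>"
    and ineq: "\<And>t. t \<in> {c..d} \<Longrightarrow> y' t \<ge> - \<alpha> t * y t"
    and "y c \<ge> 0" and t: "t \<in> {c..d}"
  shows "y t \<ge> 0"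
proof -
  obtain A where A: "A c = 0"
    "\<And>t. t \<in> {c..d} \<Longrightarrow> (A has_real_derivative \<alpha> t) (at t within {c..d})"
    using exists_antiderivative[OF \<alpha>] by blast
  have der': "((\<lambda>x. exp (A x) * y x) has_real_derivative exp (A x) * (y' x + \<alpha> x * y x))
      (at x within {c..t})" if "x \<in> {c..t}" for x
  proof -
    have x: "x \<in> {c..d}" using that t by auto
    have "((\<lambda>x. exp (A x) * y x) has_real_derivative exp (A x) * (y' x + \<alpha> x * y x))
        (at x within {c..d})"
      by (rule derivative_eq_intros A(2) der x refl)+ (simp add: algebra_simps)
    then show ?thesis by (rule DERIV_subset) (use t in auto)
  qed
  have "exp (A c) * y c \<le> exp (A t) * y t"
  proof (rule mono_from_deriv_within[where f = "\<lambda>x. exp (A x) * y x"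
        and f' = "\<lambda>x. exp (A x) * (y' x + \<alpha> x * y x)"])
    show "continuous_on {c..t} (\<lambda>x. exp (A x) * y x)" by (rule DERIV_continuous_on[OF der'])
    fix x assume "x \<in> {c<..<t}"
    then show "0 \<le> exp (A x) * (y' x + \<alpha> x * y x)"
      using ineq[of x] t by auto
  qed (use t der' in auto)
  with A(1) \<open>y c \<ge> 0\<close> have "0 \<le> exp (A t) * y t" by simp
  then show ?thesis by (simp add: zero_le_mult_iff)
qed

lemma exists_scalar_linear_ode_solution:
  fixes \<alpha> g :: "real \<Rightarrow> real"
  assumes \<alpha>: "continuous_on {c..d} \<alpha>" and g: "continuous_on {c..d} g"
  shows "\<exists>x. x c = x0 \<and>
    (\<forall>t\<in>{c..d}. (x has_real_derivative - \<alpha> t * x t + g t) (at t within {c..d}))"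
proof -
  obtain A where A: "A c = 0"
    "\<And>t. t \<in> {c..d} \<Longrightarrow> (A has_real_derivative \<alpha> t) (at t within {c..d})"
    using exists_antiderivative[OF \<alpha>] by blast
  have "continuous_on {c..d} A"
    by (rule DERIV_continuous_on[OF A(2)])
  then have "continuous_on {c..d} (\<lambda>t. exp (A t) * g t)"
    by (intro continuous_intros g)
  then obtain H where H: "H c = 0"
    "\<And>t. t \<in> {c..d} \<Longrightarrow> (H has_real_derivative exp (A t) * g t) (at t within {c..d})"
    using exists_antiderivative by blast
  define x where "x = (\<lambda>t. exp (- A t) * (x0 + H t))"
  have "(x has_real_derivative - \<alpha> t * x t + g t) (at t within {c..d})" if t: "t \<in> {c..d}" for t
    unfolding x_def
    by (rule derivative_eq_intros A(2) H(2) t refl)+ (simp add: algebra_simps exp_minus)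
  moreover have "x c = x0" by (simp add: x_def A H)
  ultimately show ?thesis by blast
qed

text \<open>Component \<open>k\<close> is driven by components below \<open>k\<close>, so each
  induction step is one scalar linear equation with a known continuous forcing.\<close>

lemma exists_lower_triangular_ode_solution:
  fixes \<alpha> :: "nat \<Rightarrow> real \<Rightarrow> real" and \<beta> :: "nat \<Rightarrow> nat \<Rightarrow> real \<Rightarrow> real"
  assumes "\<And>k. k \<in> {1..N} \<Longrightarrow> continuous_on {c..d} (\<alpha> k)"
    and "\<And>i k. i \<in> {1..N} \<Longrightarrow> k \<in> {1..N} \<Longrightarrow> continuous_on {c..d} (\<beta> i k)"
  shows "\<exists>x. \<forall>k\<in>{1..N}. x k c = x0 k \<and> (\<forall>t\<in>{c..d}.
    (x k has_real_derivative - \<alpha> k t * x k t + (\<Sum>i=1..k-1. \<beta> i k t * x i t)) (at t within {c..d}))"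
  using assms
proof (induction N)
  case (Suc N)
  have "\<exists>x. \<forall>k\<in>{1..N}. x k c = x0 k \<and> (\<forall>t\<in>{c..d}.
    (x k has_real_derivative - \<alpha> k t * x k t + (\<Sum>i=1..k-1. \<beta> i k t * x i t)) (at t within {c..d}))"
    by (rule Suc.IH) (use Suc.prems in auto)
  then obtain x where x: "\<And>k. k \<in> {1..N} \<Longrightarrow> x k c = x0 k"
    "\<And>k t. k \<in> {1..N} \<Longrightarrow> t \<in> {c..d} \<Longrightarrow>
     (x k has_real_derivative - \<alpha> k t * x k t + (\<Sum>i=1..k-1. \<beta> i k t * x i t)) (at t within {c..d})"
    by blast
  have "continuous_on {c..d} (x k)" if "k \<in> {1..N}" for k
    by (rule DERIV_continuous_on[OF x(2)[OF that]])
  then have "continuous_on {c..d} (\<lambda>t. \<Sum>i=1..N. \<beta> i (Suc N) t * x i t)"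
    using Suc.prems by (intro continuous_intros) auto
  moreover have "continuous_on {c..d} (\<alpha> (Suc N))" using Suc.prems by auto
  ultimately obtain z where z: "z c = x0 (Suc N)"
    "\<And>t. t \<in> {c..d} \<Longrightarrow> (z has_real_derivative - \<alpha> (Suc N) t * z t +
       (\<Sum>i=1..N. \<beta> i (Suc N) t * x i t)) (at t within {c..d})"
    using exists_scalar_linear_ode_solution[of c d "\<alpha> (Suc N)" _ "x0 (Suc N)"] by blast
  have old: "(\<Sum>i=1..k-1. \<beta> i k t * (x(Suc N := z)) i t) = (\<Sum>i=1..k-1. \<beta> i k t * x i t)"
    if "k \<le> Suc N" for k t
    using that by (intro sum.cong) auto
  show ?case
  proof (intro exI[of _ "x(Suc N := z)"] ballI)
    fix k assume k: "k \<in> {1..Suc N}"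
    show "(x(Suc N := z)) k c = x0 k \<and> (\<forall>t\<in>{c..d}. ((x(Suc N := z)) k has_real_derivative
      - \<alpha> k t * (x(Suc N := z)) k t + (\<Sum>i=1..k-1. \<beta> i k t * (x(Suc N := z)) i t)) (at t within {c..d}))"
    proof (cases "k = Suc N")
      case True
      then show ?thesis using z old[of "Suc N"] by simp
    next
      case False
      then have "k \<in> {1..N}" using k by auto
      then show ?thesis using x old[of k] False by simp
    qed
  qed
qed simp

lemma exists_upper_triangular_ode_solution:
  fixes \<alpha> :: "nat \<Rightarrow> real \<Rightarrow> real" and \<beta> :: "nat \<Rightarrow> nat \<Rightarrow> real \<Rightarrow> real"
  assumes \<alpha>: "\<And>k. k \<in> {1..N} \<Longrightarrow> continuous_on {c..d} (\<alpha> k)"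
    and \<beta>: "\<And>i k. i \<in> {1..N} \<Longrightarrow> k \<in> {1..N} \<Longrightarrow> continuous_on {c..d} (\<beta> i k)"
  shows "\<exists>x. \<forall>k\<in>{1..N}. x k c = x0 k \<and> (\<forall>t\<in>{c..d}.
    (x k has_real_derivative - \<alpha> k t * x k t + (\<Sum>i=k+1..N. \<beta> k i t * x i t)) (at t within {c..d}))"
proof -
  \<comment> \<open>Reversing the order of the indices makes an upper triangular system lower
    triangular; \<open>r\<close> is its own inverse on \<open>{1..N}\<close>.\<close>
  define r where "r k = N + 1 - k" for k
  have r: "r k \<in> {1..N}" "r (r k) = k" if "k \<in> {1..N}" for k
    using that by (auto simp: r_def)
  have "\<exists>x. \<forall>k\<in>{1..N}. x k c = x0 (r k) \<and> (\<forall>t\<in>{c..d}. (x k has_real_derivative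
      - \<alpha> (r k) t * x k t + (\<Sum>i=1..k-1. \<beta> (r k) (r i) t * x i t)) (at t within {c..d}))"
    by (rule exists_lower_triangular_ode_solution) (intro \<alpha> \<beta> r; assumption)+
  then obtain x where x: "\<And>k. k \<in> {1..N} \<Longrightarrow> x k c = x0 (r k)"
    "\<And>k t. k \<in> {1..N} \<Longrightarrow> t \<in> {c..d} \<Longrightarrow> (x k has_real_derivative
      - \<alpha> (r k) t * x k t + (\<Sum>i=1..k-1. \<beta> (r k) (r i) t * x i t)) (at t within {c..d})"
    by blast
  have sum: "(\<Sum>i=1..r k-1. \<beta> k (r i) t * x i t) = (\<Sum>i=k+1..N. \<beta> k i t * x (r i) t)"
    if "k \<in> {1..N}" for k t
    using that by (intro sum.reindex_bij_witness[of _ r r]) (auto simp: r_def)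
  show ?thesis
  proof (intro exI[of _ "\<lambda>k. x (r k)"] ballI conjI)
    fix k assume k: "k \<in> {1..N}"
    show "x (r k) c = x0 k" using x(1)[OF r(1)[OF k]] r[OF k] by simp
    fix t assume "t \<in> {c..d}"
    then show "(x (r k) has_real_derivative - \<alpha> k t * x (r k) t + (\<Sum>i=k+1..N. \<beta> k i t * x (r i) t))
        (at t within {c..d})"
      using x(2)[OF r(1)[OF k], of t] r[OF k] sum[OF k] by simp
  qed
qed

text \<open>The constant may depend on the base point \<open>s\<close>, as it does in (A5) and (A6)
  through the factor \<open>1 + a n s\<close>.\<close>

lemma continuous_on_if_Holder:
  fixes f :: "real \<Rightarrow> real"
  assumes "0 < \<sigma>" and holder: "\<And>s t. s \<in> S \<Longrightarrow> t \<in> S \<Longrightarrow> \<bar>f t - f s\<bar> \<le> L s * \<bar>t - s\<bar> powr \<sigma>"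
  shows "continuous_on S f"
  unfolding continuous_on_def
proof
  fix s assume s: "s \<in> S"
  have "((\<lambda>t. \<bar>t - s\<bar> powr \<sigma>) \<longlongrightarrow> 0) (at s within S)"
    by (rule tendsto_zero_powrI[where b = \<sigma>]) (use \<open>0 < \<sigma>\<close> in \<open>auto intro!: tendsto_eq_intros\<close>)
  then have "((\<lambda>t. L s * \<bar>t - s\<bar> powr \<sigma>) \<longlongrightarrow> 0) (at s within S)"
    by (rule tendsto_mult_right_zero)
  then have "((\<lambda>t. f t - f s) \<longlongrightarrow> 0) (at s within S)"
    by (rule Lim_null_comparison[rotated])
      (use holder[OF s] in \<open>auto simp: eventually_at_filter\<close>)
  then show "(f \<longlongrightarrow> f s) (at s within S)" by (simp add: LIM_zero_iff)
qed

text \<open>The distance of two solutions need not be differentiable, but dissipativity bounds its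
  backward differences, and this is what the third hypothesis records. The points \<open>r\<close>
  with \<open>g t - g r \<le> \<epsilon> * (t - r)\<close> form a closed set, and its smallest
  element could be pushed further to the left unless it is \<open>s\<close>. The left end point is
  reached by continuity alone, since the differential equation says nothing there.\<close>

lemma nonincreasing_if_left_Dini_nonpos:
  fixes g :: "real \<Rightarrow> real"
  assumes cont: "continuous_on {s..t} g" and "s \<le> t"
    and dini: "\<And>r \<epsilon>. s < r \<Longrightarrow> r \<le> t \<Longrightarrow> 0 < \<epsilon> \<Longrightarrow>
      \<exists>\<delta>>0. \<forall>r'. s < r' \<and> r - \<delta> < r' \<and> r' < r \<longrightarrow> g r - g r' \<le> \<epsilon> * (r - r')"
  shows "g t \<le> g s"
proof -
  have "g t - g s \<le> \<epsilon> * (t - s)" if \<epsilon>: "\<epsilon> > 0" for \<epsilon>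
  proof -
    define R where "R = {r \<in> {s..t}. g t - g r \<le> \<epsilon> * (t - r)}"
    have "closed R"
      unfolding R_def
      by (rule continuous_on_closed_Collect_le) (intro continuous_intros cont closed_real_atLeastAtMost)+
    have "t \<in> R" using \<open>s \<le> t\<close> by (simp add: R_def)
    have bdd: "bdd_below R" by (rule bdd_belowI[of _ s]) (simp add: R_def)
    have r0: "Inf R \<in> R"
      using closed_contains_Inf[OF _ bdd \<open>closed R\<close>] \<open>t \<in> R\<close> by blast
    have "Inf R = s"
    proof (rule ccontr)
      assume "Inf R \<noteq> s"
      then have *: "s < Inf R" "Inf R \<le> t" using r0 by (auto simp: R_def)
      obtain \<delta> where \<delta>: "\<delta> > 0"
        "\<And>r'. s < r' \<Longrightarrow> Inf R - \<delta> < r' \<Longrightarrow> r' < Inf R \<Longrightarrow> g (Inf R) - g r' \<le> \<epsilon> * (Inf R - r')"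
        using dini[OF * \<epsilon>] by blast
      define r' where "r' = max ((s + Inf R) / 2) (Inf R - \<delta> / 2)"
      have r': "s < r'" "Inf R - \<delta> < r'" "r' < Inf R"
        using * \<delta>(1) by (auto simp: r'_def max_def)
      have "g t - g r' \<le> \<epsilon> * (t - r')"
        using \<delta>(2)[OF r'] r0 by (simp add: R_def algebra_simps)
      then have "r' \<in> R" using r' * by (auto simp: R_def)
      then show False using cInf_lower[OF _ bdd] r'(3) by force
    qed
    then show ?thesis using r0 by (simp add: R_def)
  qed
  note le = this
  show ?thesis
  proof (rule field_le_epsilon)
    fix e :: real assume e: "e > 0"
    have "g t - g s \<le> e / (t - s + 1) * (t - s)" using le[of "e / (t - s + 1)"] e \<open>s \<le> t\<close> by simp
    also have "\<dots> \<le> e" using e \<open>s \<le> t\<close> by (simp add: field_simps)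
    finally show "g t \<le> g s + e" by simp
  qed
qed

section \<open>The frozen adjoint system\<close>

text \<open>
  \<open>q\<close> solves the adjoint system \<open>q' = q G\<close> with \<open>q 0 = w\<close>; its dissipation rate \<open>p = - q'\<close> solves
  the same system. For \<open>(1 - \<kappa>) * \<alpha> k * \<tau> \<le> 1\<close> the bound on \<open>p\<close> follows from \<open>p k \<le> \<alpha> k * w k\<close>;
  afterwards \<open>w k / ((1 - \<kappa>) * \<tau>)\<close> is a supersolution, by induction on \<open>k\<close>.
\<close>

lemma exists_frozen_dissipation_rate:
  fixes \<alpha> w :: "nat \<Rightarrow> real" and \<beta> :: "nat \<Rightarrow> nat \<Rightarrow> real"
  assumes \<alpha>: "\<And>k. k \<in> {1..N} \<Longrightarrow> \<alpha> k \<ge> 0"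
    and w: "\<And>k. k \<in> {1..N} \<Longrightarrow> w k > 0"
    and \<beta>: "\<And>n k. n \<in> {1..N} \<Longrightarrow> k \<in> {1..N} \<Longrightarrow> \<beta> n k \<ge> 0"
    and \<kappa>: "0 < \<kappa>" "\<kappa> < 1"
    and sub: "\<And>k. k \<in> {1..N} \<Longrightarrow> (\<Sum>n=1..k-1. w n * \<beta> n k) \<le> \<kappa> * w k"
    and "0 \<le> d"
  obtains p :: "nat \<Rightarrow> real \<Rightarrow> real" where
    "\<And>k. k \<in> {1..N} \<Longrightarrow> p k 0 = \<alpha> k * (w k - (\<Sum>n=1..k-1. w n * \<beta> n k))"
    "\<And>k t. k \<in> {1..N} \<Longrightarrow> t \<in> {0..d} \<Longrightarrow> (p k has_real_derivative
        - (\<alpha> k * p k t) + \<alpha> k * (\<Sum>n=1..k-1. p n t * \<beta> n k)) (at t within {0..d})"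
    "\<And>k t. k \<in> {1..N} \<Longrightarrow> t \<in> {0..d} \<Longrightarrow> 0 \<le> p k t"
    "\<And>k t. k \<in> {1..N} \<Longrightarrow> t \<in> {0<..d} \<Longrightarrow> p k t \<le> w k / ((1 - \<kappa>) * t)"
proof -
  obtain q where q: "\<forall>k\<in>{1..N}. q k 0 = w k \<and> (\<forall>t\<in>{0..d}.
     (q k has_real_derivative - \<alpha> k * q k t + (\<Sum>n=1..k-1. (\<alpha> k * \<beta> n k) * q n t)) (at t within {0..d}))"
    using exists_lower_triangular_ode_solution[of N 0 d "\<lambda>k _. \<alpha> k" "\<lambda>n k _. \<alpha> k * \<beta> n k" w,
        OF continuous_on_const continuous_on_const] ..
  have q0: "\<And>k. k \<in> {1..N} \<Longrightarrow> q k 0 = w k"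
    and q': "\<And>k t. k \<in> {1..N} \<Longrightarrow> t \<in> {0..d} \<Longrightarrow>
       (q k has_real_derivative - \<alpha> k * q k t + (\<Sum>n=1..k-1. (\<alpha> k * \<beta> n k) * q n t)) (at t within {0..d})"
    using q by simp_all
  \<comment> \<open>The constant state \<open>w\<close> is a supersolution of the adjoint system: by
    \<open>sub\<close> and \<open>\<kappa> < 1\<close> the inflow into component \<open>k\<close> is
    at most \<open>\<alpha> k * w k\<close>.\<close>
  have q_bounds: "0 \<le> q k t \<and> q k t \<le> w k" if "k \<in> {1..N}" "t \<in> {0..d}" for k t
    using that
  proof (induction k arbitrary: t rule: less_induct)
    case (less k)
    have IH: "0 \<le> q n t" "q n t \<le> w n" "0 \<le> \<beta> n k" if "n \<in> {1..k-1}" "t \<in> {0..d}" for n t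
      using less.IH[of n t] \<beta>[of n k] less.prems that by auto
    have nn: "0 \<le> q k t"
    proof (rule linear_differential_inequality_nonneg[OF q'[OF less.prems(1)] continuous_on_const])
      fix t assume t: "t \<in> {0..d}"
      have "0 \<le> (\<Sum>n=1..k-1. (\<alpha> k * \<beta> n k) * q n t)"
        using IH[OF _ t] \<alpha>[OF less.prems(1)] by (intro sum_nonneg mult_nonneg_nonneg) auto
      then show "- \<alpha> k * q k t \<le> - \<alpha> k * q k t + (\<Sum>n=1..k-1. (\<alpha> k * \<beta> n k) * q n t)"
        by simp
    next
      show "0 \<le> q k 0" using q0 w less.prems(1) by (simp add: less_imp_le)
    qed (use less.prems in auto)
    have le: "(\<Sum>n=1..k-1. (\<alpha> k * \<beta> n k) * q n t) \<le> \<alpha> k * w k" if t: "t \<in> {0..d}" for t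
    proof -
      have "(\<Sum>n=1..k-1. (\<alpha> k * \<beta> n k) * q n t) = \<alpha> k * (\<Sum>n=1..k-1. q n t * \<beta> n k)"
        by (simp add: sum_distrib_left mult_ac)
      also have "(\<Sum>n=1..k-1. q n t * \<beta> n k) \<le> (\<Sum>n=1..k-1. w n * \<beta> n k)"
        using IH[OF _ t] by (intro sum_mono mult_right_mono) auto
      also have "\<dots> \<le> \<kappa> * w k" using sub less.prems by blast
      also have "\<dots> \<le> 1 * w k" using \<kappa> w[OF less.prems(1)] by (intro mult_right_mono) auto
      finally show ?thesis using \<alpha>[OF less.prems(1)] by (simp add: mult_left_mono)
    qed
    have "0 \<le> w k - q k t"
    proof (rule linear_differential_inequality_nonneg[where \<alpha> = "\<lambda>_. \<alpha> k" and c = 0 and d = d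
          and y = "\<lambda>t. w k - q k t"])
      fix t assume t: "t \<in> {0..d}"
      show "((\<lambda>t. w k - q k t) has_real_derivative
          - (- \<alpha> k * q k t + (\<Sum>n=1..k-1. (\<alpha> k * \<beta> n k) * q n t))) (at t within {0..d})"
        using DERIV_diff[OF DERIV_const q'[OF less.prems(1) t], of "w k"] by simp
      show "- \<alpha> k * (w k - q k t) \<le> - (- \<alpha> k * q k t + (\<Sum>n=1..k-1. (\<alpha> k * \<beta> n k) * q n t))"
        using le[OF t] by (simp add: algebra_simps)
    qed (use less.prems q0 in auto)
    with nn show ?case by simp
  qed
  define p where "p k t = \<alpha> k * (q k t - (\<Sum>n=1..k-1. q n t * \<beta> n k))" for k t
  have qp: "(q k has_real_derivative - p k t) (at t within {0..d})"
    if "k \<in> {1..N}" "t \<in> {0..d}" for k t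
    using q'[OF that] by (simp add: p_def algebra_simps sum_distrib_left)
  have p': "(p k has_real_derivative - (\<alpha> k * p k t) + \<alpha> k * (\<Sum>n=1..k-1. p n t * \<beta> n k))
      (at t within {0..d})" if k: "k \<in> {1..N}" and t: "t \<in> {0..d}" for k t
  proof -
    have "((\<lambda>t. \<alpha> k * (q k t - (\<Sum>n=1..k-1. q n t * \<beta> n k))) has_real_derivative
        \<alpha> k * (- p k t - (\<Sum>n=1..k-1. - p n t * \<beta> n k))) (at t within {0..d})"
      using k by (intro DERIV_cmult DERIV_diff DERIV_sum DERIV_cmult_right qp k t) auto
    moreover have "(\<lambda>t. \<alpha> k * (q k t - (\<Sum>n=1..k-1. q n t * \<beta> n k))) = p k"
      by (simp add: p_def fun_eq_iff)
    ultimately have "(p k has_real_derivative \<alpha> k * (- p k t - (\<Sum>n=1..k-1. - p n t * \<beta> n k)))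
        (at t within {0..d})" by simp
    then show ?thesis
      by (rule DERIV_cong) (simp add: sum_negf right_diff_distrib)
  qed
  have p0: "p k 0 = \<alpha> k * (w k - (\<Sum>n=1..k-1. w n * \<beta> n k))" if "k \<in> {1..N}" for k
  proof -
    have "(\<Sum>n=1..k-1. q n 0 * \<beta> n k) = (\<Sum>n=1..k-1. w n * \<beta> n k)"
      using that q0 by (intro sum.cong) auto
    then show ?thesis using q0[OF that] by (simp add: p_def)
  qed
  have p0_nonneg: "0 \<le> p k 0" if k: "k \<in> {1..N}" for k
  proof -
    have "\<kappa> * w k \<le> 1 * w k" using \<kappa> w[OF k] by (intro mult_right_mono) auto
    then show ?thesis unfolding p0[OF k] using sub[OF k] \<alpha>[OF k] by (intro mult_nonneg_nonneg) auto
  qed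
  have p_nonneg: "0 \<le> p k t" if "k \<in> {1..N}" "t \<in> {0..d}" for k t
    using that
  proof (induction k arbitrary: t rule: less_induct)
    case (less k)
    show ?case
    proof (rule linear_differential_inequality_nonneg[OF p'[OF less.prems(1)] continuous_on_const])
      fix t assume t: "t \<in> {0..d}"
      have "0 \<le> \<alpha> k * (\<Sum>n=1..k-1. p n t * \<beta> n k)"
        using less.IH[of _ t] less.prems \<alpha> \<beta> t
        by (intro mult_nonneg_nonneg sum_nonneg) auto
      then show "- \<alpha> k * p k t \<le> - (\<alpha> k * p k t) + \<alpha> k * (\<Sum>n=1..k-1. p n t * \<beta> n k)" by simp
    qed (use p0_nonneg less.prems in auto)
  qed
  have p_le: "p k t \<le> \<alpha> k * w k" if "k \<in> {1..N}" "t \<in> {0..d}" for k t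
  proof -
    have "0 \<le> (\<Sum>n=1..k-1. q n t * \<beta> n k)"
      using q_bounds \<beta> that by (intro sum_nonneg mult_nonneg_nonneg) auto
    then show ?thesis
      unfolding p_def using \<alpha>[OF that(1)] q_bounds[OF that] by (intro mult_left_mono) auto
  qed
  have p_decay: "p k t \<le> w k / ((1 - \<kappa>) * t)" if "k \<in> {1..N}" "t \<in> {0<..d}" for k t
    using that
  proof (induction k arbitrary: t rule: less_induct)
    case (less k)
    define M where "M = w k / (1 - \<kappa>)"
    note k = less.prems(1) and t = less.prems(2)
    have M: "M > 0" using \<kappa> w[OF k] by (simp add: M_def)
    have eqM: "w n / ((1 - \<kappa>) * r) = w n / (1 - \<kappa>) / r" for n r by simp
    show ?case
    proof (cases "(1 - \<kappa>) * \<alpha> k * t \<le> 1")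
      case True
      then have "\<alpha> k * ((1 - \<kappa>) * t) \<le> 1" by (simp add: mult_ac)
      then have "\<alpha> k \<le> 1 / ((1 - \<kappa>) * t)" using t \<kappa> by (subst pos_le_divide_eq) auto
      then have "\<alpha> k * w k \<le> 1 / ((1 - \<kappa>) * t) * w k"
        using w[OF k] by (intro mult_right_mono) auto
      then show ?thesis using p_le[OF k, of t] t by simp
    next
      case False
      have \<alpha>k: "\<alpha> k > 0"
      proof (rule ccontr)
        assume "\<not> \<alpha> k > 0"
        then have "\<alpha> k = 0" using \<alpha>[OF k] by simp
        then show False using False by simp
      qed
      \<comment> \<open>From \<open>t0\<close> on, \<open>M / r\<close> decays more slowly than the
        net rate \<open>(1 - \<kappa>) * \<alpha> k\<close> that remains after the inflow is
        subtracted, hence it is a supersolution there. Also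
        \<open>M / t0 = \<alpha> k * w k\<close>, so the crude bound \<open>p_le\<close> starts the
        comparison exactly at \<open>t0\<close>.\<close>
      define t0 where "t0 = 1 / ((1 - \<kappa>) * \<alpha> k)"
      have t0: "0 < t0" "t0 < t" "t \<le> d"
        using False \<alpha>k \<kappa> t by (auto simp: t0_def field_simps)
      have "0 \<le> M / t - p k t"
      proof (rule linear_differential_inequality_nonneg[where \<alpha> = "\<lambda>_. \<alpha> k" and c = t0 and d = d
            and y = "\<lambda>r. M / r - p k r"])
        fix r assume r: "r \<in> {t0..d}"
        have "((\<lambda>r. M / r - p k r) has_real_derivative - (M / r\<^sup>2)
            - (- (\<alpha> k * p k r) + \<alpha> k * (\<Sum>n=1..k-1. p n r * \<beta> n k))) (at r within {0..d})"
          using r t0 by (auto intro!: derivative_eq_intros p' k simp: power2_eq_square)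
        then show "((\<lambda>r. M / r - p k r) has_real_derivative - (M / r\<^sup>2)
            - (- (\<alpha> k * p k r) + \<alpha> k * (\<Sum>n=1..k-1. p n r * \<beta> n k))) (at r within {t0..d})"
          by (rule DERIV_subset) (use t0 in auto)
        have rpos: "r > 0" using r t0 by auto
        have "(\<Sum>n=1..k-1. p n r * \<beta> n k) \<le> (\<Sum>n=1..k-1. (w n / ((1 - \<kappa>) * r)) * \<beta> n k)"
          using less.IH[of _ r] r t0 k \<beta> by (intro sum_mono mult_right_mono) auto
        also have "\<dots> = (\<Sum>n=1..k-1. w n * \<beta> n k) / ((1 - \<kappa>) * r)"
          by (simp add: sum_divide_distrib)
        also have "\<dots> \<le> \<kappa> * w k / ((1 - \<kappa>) * r)"
          using sub[OF k] \<kappa> rpos by (intro divide_right_mono) auto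
        also have "\<dots> = \<kappa> * (M / r)" by (simp add: M_def)
        finally have S: "\<alpha> k * (\<Sum>n=1..k-1. p n r * \<beta> n k) \<le> \<alpha> k * (\<kappa> * (M / r))"
          using \<alpha>k by (intro mult_left_mono) auto
        have "1 \<le> (1 - \<kappa>) * \<alpha> k * r"
          using r \<alpha>k \<kappa> by (simp add: t0_def field_simps)
        then have "M / r\<^sup>2 * 1 \<le> M / r\<^sup>2 * ((1 - \<kappa>) * \<alpha> k * r)"
          using M by (intro mult_left_mono) auto
        also have "\<dots> = (1 - \<kappa>) * \<alpha> k * (M / r)" using rpos by (simp add: power2_eq_square)
        finally show "- \<alpha> k * (M / r - p k r)
            \<le> - (M / r\<^sup>2) - (- (\<alpha> k * p k r) + \<alpha> k * (\<Sum>n=1..k-1. p n r * \<beta> n k))"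
          using S by (simp add: algebra_simps)
      next
        have "M / t0 = \<alpha> k * w k" using \<alpha>k \<kappa> by (simp add: t0_def M_def)
        then show "0 \<le> M / t0 - p k t0" using p_le[OF k, of t0] t0 by simp
      qed (use t0 in auto)
      then show ?thesis by (simp add: M_def)
    qed
  qed
  show ?thesis using that[of p] p0 p' p_nonneg p_decay by blast
qed

section \<open>Matrix operators on the weighted space\<close>

lemma at_within_eq_atin:
  assumes "x \<in> S"
  shows "atin (top_of_set S) x = at x within S"
proof -
  have "eventually P (atin (top_of_set S) x) \<longleftrightarrow> eventually P (at x within S)" for P
    unfolding atin_subtopology_within[OF assms] eventually_atin_within eventually_at_topological
    by auto
  then show ?thesis by (simp add: filter_eq_iff)
qed

definition matrix_op :: "(nat \<Rightarrow> nat \<Rightarrow> real) \<Rightarrow> cseq \<Rightarrow> cseq" where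
  "matrix_op m f = (\<lambda>n. \<Sum>\<^sub>\<infinity>j\<in>{1..}. complex_of_real (m n j) * f j)"

lemma matrix_op_ident:
  assumes "f 0 = 0"
  shows "matrix_op (\<lambda>n j. if n = j \<and> 1 \<le> n then 1 else 0) f = f"
proof
  fix n
  have "matrix_op (\<lambda>n j. if n = j \<and> 1 \<le> n then 1 else 0) f n
      = (\<Sum>\<^sub>\<infinity>j\<in>{n}. if 1 \<le> n then f j else 0)"
    unfolding matrix_op_def by (rule infsum_cong_neutral) auto
  also have "\<dots> = f n" using assms by (cases "n = 0") auto
  finally show "matrix_op (\<lambda>n j. if n = j \<and> 1 \<le> n then 1 else 0) f n = f n" .
qed

locale weight =
  fixes w :: "nat \<Rightarrow> real"
  assumes w_pos: "\<And>n. 1 \<le> n \<Longrightarrow> 0 < w n"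
begin

lemma summable_ell1: "f \<in> ell1 w \<Longrightarrow> (\<lambda>n. w n * cmod (f n)) summable_on {1..}"
  by (simp add: ell1_def)

lemma ell1_norm_nonneg: "0 \<le> ell1_norm w f"
  unfolding ell1_norm_def using w_pos by (intro infsum_nonneg) (simp add: less_imp_le)

lemma ell1_scale:
  assumes "f \<in> ell1 w"
  shows "(\<lambda>n. c * f n) \<in> ell1 w" "ell1_norm w (\<lambda>n. c * f n) = cmod c * ell1_norm w f"
proof -
  have eq: "(\<lambda>n. w n * cmod (c * f n)) = (\<lambda>n. cmod c * (w n * cmod (f n)))"
    by (simp add: norm_mult mult_ac)
  show "(\<lambda>n. c * f n) \<in> ell1 w"
    using assms by (simp add: ell1_def eq summable_on_cmult_right)
  show "ell1_norm w (\<lambda>n. c * f n) = cmod c * ell1_norm w f"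
    unfolding ell1_norm_def eq by (rule infsum_cmult_right')
qed

lemma ell1_zero: "(\<lambda>n. 0) \<in> ell1 w" "ell1_norm w (\<lambda>n. 0) = 0"
  by (simp_all add: ell1_def ell1_norm_def)

lemmas ell1_diff' = ell1_diff[of w, OF w_pos]

lemma ell1_norm_minus_commute: "ell1_norm w (\<lambda>n. f n - g n) = ell1_norm w (\<lambda>n. g n - f n)"
  by (simp add: ell1_norm_def norm_minus_commute)

lemma ell1_norm_diff_triangle:
  assumes "f \<in> ell1 w" "g \<in> ell1 w" "h \<in> ell1 w"
  shows "ell1_norm w (\<lambda>n. f n - h n)
    \<le> ell1_norm w (\<lambda>n. f n - g n) + ell1_norm w (\<lambda>n. g n - h n)"
  using Metric_space.triangle[OF Metric_space_ell1[of w, OF w_pos] assms]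
  by (simp add: ell1_dist_def)

lemma ell1_norm_triangle_sub:
  assumes "f \<in> ell1 w" "g \<in> ell1 w"
  shows "ell1_norm w f \<le> ell1_norm w g + ell1_norm w (\<lambda>n. f n - g n)"
  using ell1_norm_diff_triangle[OF assms ell1_zero(1)] by simp

lemma ell1_add:
  assumes "f \<in> ell1 w" "g \<in> ell1 w"
  shows "(\<lambda>n. f n + g n) \<in> ell1 w"
    "ell1_norm w (\<lambda>n. f n + g n) \<le> ell1_norm w f + ell1_norm w g"
proof -
  have g': "(\<lambda>n. - g n) \<in> ell1 w" "ell1_norm w (\<lambda>n. - g n) = ell1_norm w g"
    using ell1_scale[OF assms(2), of "-1"] by simp_all
  show "(\<lambda>n. f n + g n) \<in> ell1 w" using ell1_diff'[OF _ assms(1) g'(1)] by simp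
  show "ell1_norm w (\<lambda>n. f n + g n) \<le> ell1_norm w f + ell1_norm w g"
    using ell1_norm_diff_triangle[OF assms(1) ell1_zero(1) g'(1)] by (simp add: g')
qed

lemma limitin_ell1_iff:
  "limitin (ell1_top w) f l F \<longleftrightarrow>
    l \<in> ell1 w \<and> (\<forall>\<^sub>F x in F. f x \<in> ell1 w) \<and> ((\<lambda>x. ell1_norm w (\<lambda>n. f x n - l n)) \<longlongrightarrow> 0) F"
  unfolding ell1_top_def ell1_dist_def[symmetric]
  by (rule Metric_space.limitin_metric_dist_null[OF Metric_space_ell1]) (rule w_pos)

lemma continuous_map_ell1_iff:
  "continuous_map (top_of_set S) (ell1_top w) f \<longleftrightarrow>
    (\<forall>x\<in>S. limitin (ell1_top w) f (f x) (at x within S))"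
  by (simp add: continuous_map_atin at_within_eq_atin)

text \<open>The operator norm of a matrix on a weighted l1 space is the supremum of its weighted
  column sums, so \<open>K\<close> bounds the norm; triangularity makes each of these sums finite.
  Row 0 must vanish because \<open>ell1\<close> fixes the entry at index 0.\<close>

definition column_bounded :: "(nat \<Rightarrow> nat \<Rightarrow> real) \<Rightarrow> real \<Rightarrow> bool" where
  "column_bounded m K \<longleftrightarrow> (\<forall>n j. n = 0 \<or> j < n \<longrightarrow> m n j = 0) \<and>
     (\<forall>j\<ge>1. (\<Sum>n=1..j. w n * \<bar>m n j\<bar>) \<le> K * w j)"

lemma column_boundedD:
  assumes "column_bounded m K"
  shows "n = 0 \<or> j < n \<Longrightarrow> m n j = 0" "1 \<le> j \<Longrightarrow> (\<Sum>n=1..j. w n * \<bar>m n j\<bar>) \<le> K * w j"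
  using assms by (auto simp: column_bounded_def)

lemma column_bounded_entry:
  assumes m: "column_bounded m K" and nj: "1 \<le> n" "1 \<le> j"
  shows "w n * \<bar>m n j\<bar> \<le> K * w j"
proof (cases "n \<le> j")
  case True
  have "w n * \<bar>m n j\<bar> \<le> (\<Sum>n=1..j. w n * \<bar>m n j\<bar>)"
    using nj True w_pos by (intro member_le_sum) (auto simp: less_imp_le)
  then show ?thesis using column_boundedD(2)[OF m nj(2)] by linarith
next
  case False
  have "0 \<le> (\<Sum>n=1..j. w n * \<bar>m n j\<bar>)"
    using w_pos by (intro sum_nonneg) (auto simp: less_imp_le)
  then show ?thesis using False column_boundedD(1)[OF m, of n j] column_boundedD(2)[OF m nj(2)] by simp
qed

lemma column_bounded_diff:
  assumes "column_bounded m K" "column_bounded m' K'"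
  shows "column_bounded (\<lambda>n j. m n j - m' n j) (K + K')"
proof -
  have "(\<Sum>n=1..j. w n * \<bar>m n j - m' n j\<bar>) \<le> (K + K') * w j" if "1 \<le> j" for j
  proof -
    have "(\<Sum>n=1..j. w n * \<bar>m n j - m' n j\<bar>) \<le> (\<Sum>n=1..j. w n * \<bar>m n j\<bar> + w n * \<bar>m' n j\<bar>)"
      unfolding distrib_left[symmetric] using w_pos
      by (intro sum_mono mult_left_mono) (auto simp: less_imp_le)
    also have "\<dots> \<le> K * w j + K' * w j"
      unfolding sum.distrib using assms[THEN column_boundedD(2), OF that] by (rule add_mono)
    finally show ?thesis by (simp add: algebra_simps)
  qed
  then show ?thesis using assms by (auto simp: column_bounded_def)
qed

lemma matrix_op_row_abs_summable:
  assumes m: "column_bounded m K" and f: "f \<in> ell1 w"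
  shows "(\<lambda>j. cmod (complex_of_real (m n j) * f j)) summable_on {1..}"
proof (cases "n = 0")
  case True
  then show ?thesis using column_boundedD(1)[OF m] by simp
next
  case False
  have "(\<lambda>j. K / w n * (w j * cmod (f j))) summable_on {1..}"
    by (intro summable_on_cmult_right summable_ell1 f)
  then show ?thesis
  proof (rule summable_on_comparison_test)
    fix j :: nat assume "j \<in> {1..}"
    then have "\<bar>m n j\<bar> \<le> K / w n * w j"
      using column_bounded_entry[OF m, of n j] False w_pos[of n] by (simp add: field_simps)
    then have "\<bar>m n j\<bar> * cmod (f j) \<le> K / w n * w j * cmod (f j)"
      by (rule mult_right_mono) simp
    then show "cmod (complex_of_real (m n j) * f j) \<le> K / w n * (w j * cmod (f j))"
      by (simp add: norm_mult mult_ac)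
  qed simp
qed

lemmas matrix_op_row_summable = abs_summable_summable[OF matrix_op_row_abs_summable]

text \<open>Tonelli: summation by columns converges, because a column has finitely many entries and
  weighted sum at most \<open>K * w j\<close>. Norm bounds, functionals applied to images and
  products of matrices all rest on this absolute summability.\<close>

lemma matrix_op_double_has_sum:
  assumes m: "column_bounded m K" and f: "f \<in> ell1 w"
  defines "g \<equiv> \<lambda>j. (\<Sum>n=1..j. w n * \<bar>m n j\<bar>) * cmod (f j)"
  shows "g summable_on {1..}"
    and "((\<lambda>(n, j). w n * \<bar>m n j\<bar> * cmod (f j)) has_sum infsum g {1..}) ({1..} \<times> {1..})"
    and "infsum g {1..} \<le> K * ell1_norm w f"
proof -
  have g_nonneg: "0 \<le> g j" for j
    unfolding g_def using w_pos by (intro mult_nonneg_nonneg sum_nonneg) (auto simp: less_imp_le)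
  have g_le: "g j \<le> K * (w j * cmod (f j))" if "j \<in> {1..}" for j
    unfolding g_def using mult_right_mono[OF column_boundedD(2)[OF m, of j], of "cmod (f j)"] that
    by (simp add: mult_ac)
  have sm: "(\<lambda>j. K * (w j * cmod (f j))) summable_on {1..}"
    by (intro summable_on_cmult_right summable_ell1 f)
  show g: "g summable_on {1..}"
    by (rule summable_on_comparison_test[OF sm g_le g_nonneg])
  have row: "((\<lambda>n. w n * \<bar>m n j\<bar> * cmod (f j)) has_sum g j) {1..}" for j
  proof -
    have "((\<lambda>n. w n * \<bar>m n j\<bar> * cmod (f j)) has_sum g j) {1..j}"
      unfolding g_def sum_distrib_right by (rule has_sum_finite) simp
    moreover have "((\<lambda>n. w n * \<bar>m n j\<bar> * cmod (f j)) has_sum g j) {1..j} \<longleftrightarrow>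
        ((\<lambda>n. w n * \<bar>m n j\<bar> * cmod (f j)) has_sum g j) {1..}"
      by (rule has_sum_cong_neutral) (auto simp: column_boundedD(1)[OF m])
    ultimately show ?thesis by blast
  qed
  have "(\<lambda>(j, n). w n * \<bar>m n j\<bar> * cmod (f j)) summable_on ({1..} \<times> {1..})"
    by (rule summable_on_SigmaI[where g = g]) (use row g w_pos in \<open>auto simp: less_imp_le\<close>)
  then have "((\<lambda>(j, n). w n * \<bar>m n j\<bar> * cmod (f j)) has_sum infsum g {1..}) ({1..} \<times> {1..})"
    by (intro has_sum_SigmaI[where g = g]) (use row g in auto)
  then show "((\<lambda>(n, j). w n * \<bar>m n j\<bar> * cmod (f j)) has_sum infsum g {1..}) ({1..} \<times> {1..})"
    by (subst has_sum_swap) simp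
  have "infsum g {1..} \<le> infsum (\<lambda>j. K * (w j * cmod (f j))) {1..}"
    by (rule infsum_mono[OF g sm g_le])
  also have "\<dots> = K * ell1_norm w f"
    unfolding ell1_norm_def by (rule infsum_cmult_right')
  finally show "infsum g {1..} \<le> K * ell1_norm w f" .
qed

text \<open>The bound keeps the true column sums in place of \<open>K * w j\<close>: in
  \<open>limitin_matrix_op\<close> they tend to 0 column by column while \<open>K\<close> stays
  fixed.\<close>

lemma matrix_op_ell1:
  assumes m: "column_bounded m K" and f: "f \<in> ell1 w"
  shows "matrix_op m f \<in> ell1 w"
    and "ell1_norm w (matrix_op m f) \<le> (\<Sum>\<^sub>\<infinity>j\<in>{1..}. (\<Sum>n=1..j. w n * \<bar>m n j\<bar>) * cmod (f j))"
proof -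
  define h where "h n = (\<Sum>\<^sub>\<infinity>j\<in>{1..}. w n * \<bar>m n j\<bar> * cmod (f j))" for n
  define S where "S = (\<Sum>\<^sub>\<infinity>j\<in>{1..}. (\<Sum>n=1..j. w n * \<bar>m n j\<bar>) * cmod (f j))"
  have dbl: "((\<lambda>(n, j). w n * \<bar>m n j\<bar> * cmod (f j)) has_sum S) ({1..} \<times> {1..})"
    unfolding S_def by (rule matrix_op_double_has_sum(2)[OF m f])
  have le: "w n * cmod (matrix_op m f n) \<le> h n" if "n \<in> {1..}" for n
  proof -
    have "cmod (matrix_op m f n) \<le> (\<Sum>\<^sub>\<infinity>j\<in>{1..}. cmod (complex_of_real (m n j) * f j))"
      unfolding matrix_op_def by (rule norm_infsum_bound[OF matrix_op_row_abs_summable[OF m f]])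
    also have "\<dots> = (\<Sum>\<^sub>\<infinity>j\<in>{1..}. \<bar>m n j\<bar> * cmod (f j))" by (simp add: norm_mult)
    finally have "w n * cmod (matrix_op m f n) \<le> w n * (\<Sum>\<^sub>\<infinity>j\<in>{1..}. \<bar>m n j\<bar> * cmod (f j))"
      using w_pos[of n] that by (intro mult_left_mono) (auto simp: less_imp_le)
    also have "\<dots> = h n"
      unfolding h_def mult.assoc by (rule infsum_cmult_right'[symmetric])
    finally show ?thesis .
  qed
  have "h summable_on {1..}" "infsum h {1..} = S"
    using has_sum_SigmaD[OF dbl] summable_on_Sigma_banach infsum_Sigma'_banach
      has_sum_imp_summable[OF dbl] infsumI[OF dbl] unfolding h_def by fastforce+
  moreover from this(1) have "(\<lambda>n. w n * cmod (matrix_op m f n)) summable_on {1..}"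
    by (rule summable_on_comparison_test[OF _ le]) (use w_pos in \<open>auto simp: less_imp_le\<close>)
  moreover have "matrix_op m f 0 = 0" by (simp add: matrix_op_def column_boundedD(1)[OF m])
  ultimately show "matrix_op m f \<in> ell1 w" "ell1_norm w (matrix_op m f) \<le> S"
    using infsum_mono[of _ _ h, OF _ _ le] by (auto simp: ell1_def ell1_norm_def)
qed

lemma matrix_op_norm_le:
  assumes "column_bounded m K" "f \<in> ell1 w"
  shows "ell1_norm w (matrix_op m f) \<le> K * ell1_norm w f"
  using matrix_op_ell1(2)[OF assms] matrix_op_double_has_sum(3)[OF assms] by linarith

lemma matrix_op_add:
  assumes "column_bounded m K" "f \<in> ell1 w" "g \<in> ell1 w"
  shows "matrix_op m (\<lambda>n. f n + g n) = (\<lambda>n. matrix_op m f n + matrix_op m g n)"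
  unfolding matrix_op_def distrib_left
  by (intro ext infsum_add matrix_op_row_summable[OF assms(1)] assms)

lemma matrix_op_cmult: "matrix_op m (\<lambda>n. c * f n) = (\<lambda>n. c * matrix_op m f n)"
proof
  fix n
  have "matrix_op m (\<lambda>n. c * f n) n = (\<Sum>\<^sub>\<infinity>j\<in>{1..}. c * (complex_of_real (m n j) * f j))"
    by (simp add: matrix_op_def mult_ac)
  also have "\<dots> = c * matrix_op m f n" unfolding matrix_op_def by (rule infsum_cmult_right')
  finally show "matrix_op m (\<lambda>n. c * f n) n = c * matrix_op m f n" .
qed

lemma column_bounded_mono:
  assumes "column_bounded m K" "K \<le> K'"
  shows "column_bounded m K'"
proof -
  have "K * w j \<le> K' * w j" if "1 \<le> j" for j
    using assms(2) w_pos[OF that] by (intro mult_right_mono) auto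
  then show ?thesis using assms(1) unfolding column_bounded_def by fastforce
qed

lemma matrix_op_row_scale: "matrix_op (\<lambda>n j. c n * m n j) f = (\<lambda>n. complex_of_real (c n) * matrix_op m f n)"
proof
  fix n
  have "matrix_op (\<lambda>n j. c n * m n j) f n
      = (\<Sum>\<^sub>\<infinity>j\<in>{1..}. complex_of_real (c n) * (complex_of_real (m n j) * f j))"
    by (simp add: matrix_op_def mult_ac)
  also have "\<dots> = complex_of_real (c n) * matrix_op m f n" unfolding matrix_op_def by (rule infsum_cmult_right')
  finally show "matrix_op (\<lambda>n j. c n * m n j) f n = complex_of_real (c n) * matrix_op m f n" .
qed

lemma matrix_op_unit:
  assumes "1 \<le> j"
  shows "matrix_op m (\<lambda>i. if i = j then 1 else 0) n = complex_of_real (m n j)"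
proof -
  have "matrix_op m (\<lambda>i. if i = j then 1 else 0) n = (\<Sum>\<^sub>\<infinity>i\<in>{j}. complex_of_real (m n i))"
    unfolding matrix_op_def using assms by (intro infsum_cong_neutral) auto
  then show ?thesis by simp
qed

lemma unit_in_ell1:
  assumes "1 \<le> j"
  shows "(\<lambda>i. if i = j then 1 else 0) \<in> ell1 w"
proof -
  have "(\<lambda>n. w n * cmod (if n = j then 1 else 0)) summable_on {1..} \<longleftrightarrow>
      (\<lambda>n. w n * cmod (if n = j then 1 else 0)) summable_on {j}"
    using assms by (intro summable_on_cong_neutral) auto
  then show ?thesis using assms by (simp add: ell1_def)
qed

text \<open>A vanishing sum of nonnegative terms has only vanishing terms. Together with a positive
  diagonal, the second claim shows that a nonzero element of the cone has a nonzero image.\<close>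

lemma matrix_op_cone:
  assumes m: "column_bounded m K" and nonneg: "\<And>n j. 0 \<le> m n j" and f: "f \<in> ell1_cone w"
  shows "matrix_op m f \<in> ell1_cone w"
    and "matrix_op m f n = 0 \<Longrightarrow> 1 \<le> j \<Longrightarrow> m n j = 0 \<or> f j = 0"
proof -
  have f': "f \<in> ell1 w" "\<And>j. 1 \<le> j \<Longrightarrow> f j = complex_of_real (Re (f j))" "\<And>j. 1 \<le> j \<Longrightarrow> 0 \<le> Re (f j)"
    using f by (auto simp: ell1_cone_def)
  have "(\<lambda>j. Re (complex_of_real (m i j) * f j)) summable_on {1..}" for i
    by (rule summable_on_Re[OF matrix_op_row_summable[OF m f'(1)]])
  then have sm: "(\<lambda>j. m i j * Re (f j)) summable_on {1..}" for i
    by simp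
  have eq: "matrix_op m f i = complex_of_real (\<Sum>\<^sub>\<infinity>j\<in>{1..}. m i j * Re (f j))" for i
  proof -
    have "matrix_op m f i = (\<Sum>\<^sub>\<infinity>j\<in>{1..}. complex_of_real (m i j * Re (f j)))"
      unfolding matrix_op_def using f'(2) by (intro infsum_cong) simp
    also have "\<dots> = complex_of_real (\<Sum>\<^sub>\<infinity>j\<in>{1..}. m i j * Re (f j))"
      by (rule infsumI[OF has_sum_of_real[OF has_sum_infsum[OF sm]]])
    finally show ?thesis .
  qed
  have "0 \<le> (\<Sum>\<^sub>\<infinity>j\<in>{1..}. m i j * Re (f j))" for i
    using nonneg f'(3) by (intro infsum_nonneg mult_nonneg_nonneg) auto
  then show "matrix_op m f \<in> ell1_cone w"
    using matrix_op_ell1(1)[OF m f'(1)] by (simp add: ell1_cone_def eq)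
  assume "matrix_op m f n = 0" and j: "1 \<le> j"
  then have "(\<Sum>\<^sub>\<infinity>j\<in>{1..}. m n j * Re (f j)) = 0" by (simp add: eq)
  then have "m n j * Re (f j) = 0"
    by (intro nonneg_infsum_le_0D[OF _ sm]) (use nonneg f'(3) j in auto)
  then show "m n j = 0 \<or> f j = 0" using f'(2)[OF j] by auto
qed

text \<open>Used with \<open>c = r - t\<close> for difference quotients in time, and with
  \<open>c = 1\<close> as plain subtraction of operators.\<close>

lemma matrix_op_diff_quotient:
  assumes "column_bounded m K" "column_bounded m' K'" "f \<in> ell1 w"
  shows "matrix_op (\<lambda>n j. (m n j - m' n j) / c) f = (\<lambda>n. (matrix_op m f n - matrix_op m' f n) / complex_of_real c)"
proof
  fix n
  have "matrix_op (\<lambda>n j. (m n j - m' n j) / c) f n = (\<Sum>\<^sub>\<infinity>j\<in>{1..}.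
      (complex_of_real (m n j) * f j - complex_of_real (m' n j) * f j) * (1 / complex_of_real c))"
    by (simp add: matrix_op_def algebra_simps diff_divide_distrib)
  also have "\<dots> = (\<Sum>\<^sub>\<infinity>j\<in>{1..}. complex_of_real (m n j) * f j - complex_of_real (m' n j) * f j)
      * (1 / complex_of_real c)"
    by (rule infsum_cmult_left')
  also have "(\<Sum>\<^sub>\<infinity>j\<in>{1..}. complex_of_real (m n j) * f j - complex_of_real (m' n j) * f j)
      = matrix_op m f n - matrix_op m' f n"
    using infsum_add[OF matrix_op_row_summable[OF assms(1,3)] summable_on_uminus[THEN iffD2, OF matrix_op_row_summable[OF assms(2,3)]]]
    by (simp add: matrix_op_def infsum_uminus)
  finally show "matrix_op (\<lambda>n j. (m n j - m' n j) / c) f n = (matrix_op m f n - matrix_op m' f n) / complex_of_real c"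
    by simp
qed

text \<open>A row \<open>v\<close> dominated by \<open>C * w\<close> is a bounded functional, so it
  may be moved through the matrix by exchanging the sums. With \<open>v\<close> a row of a second
  matrix this gives the composition, with \<open>v n = n\<close> the first moment.\<close>

lemma infsum_weighted_matrix_op:
  assumes m: "column_bounded m K" and f: "f \<in> ell1 w"
    and v: "\<And>n. 1 \<le> n \<Longrightarrow> \<bar>v n\<bar> \<le> C * w n"
  shows "(\<Sum>\<^sub>\<infinity>n\<in>{1..}. complex_of_real (v n) * matrix_op m f n)
    = (\<Sum>\<^sub>\<infinity>j\<in>{1..}. complex_of_real (\<Sum>n=1..j. v n * m n j) * f j)"
proof -
  have "(\<lambda>(n, j). w n * \<bar>m n j\<bar> * cmod (f j)) summable_on ({1..} \<times> {1..})"
    using has_sum_imp_summable[OF matrix_op_double_has_sum(2)[OF m f]] .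
  then have "(\<lambda>x. C * (case x of (n, j) \<Rightarrow> w n * \<bar>m n j\<bar> * cmod (f j))) summable_on ({1..} \<times> {1..})"
    by (rule summable_on_cmult_right)
  then have "(\<lambda>x. cmod (case x of (n, j) \<Rightarrow> complex_of_real (v n) * (complex_of_real (m n j) * f j)))
      summable_on ({1..} \<times> {1..})"
  proof (rule summable_on_comparison_test)
    fix x :: "nat \<times> nat" assume "x \<in> {1..} \<times> {1..}"
    then obtain n j where x: "x = (n, j)" "1 \<le> n" by auto
    have "\<bar>v n\<bar> * (\<bar>m n j\<bar> * cmod (f j)) \<le> C * w n * (\<bar>m n j\<bar> * cmod (f j))"
      using v[OF x(2)] by (rule mult_right_mono) simp
    then show "cmod (case x of (n, j) \<Rightarrow> complex_of_real (v n) * (complex_of_real (m n j) * f j))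
        \<le> C * (case x of (n, j) \<Rightarrow> w n * \<bar>m n j\<bar> * cmod (f j))"
      by (simp add: x norm_mult mult_ac)
  qed simp
  then have sm: "(\<lambda>(n, j). complex_of_real (v n) * (complex_of_real (m n j) * f j))
      summable_on ({1..} \<times> {1..})"
    by (rule abs_summable_summable)
  have "(\<Sum>\<^sub>\<infinity>n\<in>{1..}. complex_of_real (v n) * matrix_op m f n)
      = (\<Sum>\<^sub>\<infinity>n\<in>{1..}. \<Sum>\<^sub>\<infinity>j\<in>{1..}. complex_of_real (v n) * (complex_of_real (m n j) * f j))"
    unfolding matrix_op_def infsum_cmult_right' ..
  also have "\<dots> = (\<Sum>\<^sub>\<infinity>j\<in>{1..}. \<Sum>\<^sub>\<infinity>n\<in>{1..}. complex_of_real (v n) * (complex_of_real (m n j) * f j))"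
    by (rule infsum_swap_banach[OF sm])
  also have "\<dots> = (\<Sum>\<^sub>\<infinity>j\<in>{1..}. complex_of_real (\<Sum>n=1..j. v n * m n j) * f j)"
  proof (rule infsum_cong)
    fix j :: nat
    have "(\<Sum>\<^sub>\<infinity>n\<in>{1..}. complex_of_real (v n) * (complex_of_real (m n j) * f j))
        = (\<Sum>\<^sub>\<infinity>n\<in>{1..j}. complex_of_real (v n) * (complex_of_real (m n j) * f j))"
      by (rule infsum_cong_neutral) (auto simp: column_boundedD(1)[OF m])
    then show "(\<Sum>\<^sub>\<infinity>n\<in>{1..}. complex_of_real (v n) * (complex_of_real (m n j) * f j))
        = complex_of_real (\<Sum>n=1..j. v n * m n j) * f j"
      by (simp add: sum_distrib_left sum_distrib_right mult_ac)
  qed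
  finally show ?thesis .
qed

lemma matrix_op_compose:
  assumes m1: "column_bounded m1 K1" and m2: "column_bounded m2 K2" and f: "f \<in> ell1 w"
  shows "matrix_op m1 (matrix_op m2 f) = matrix_op (\<lambda>n j. \<Sum>k=1..j. m1 n k * m2 k j) f"
proof
  fix n
  show "matrix_op m1 (matrix_op m2 f) n = matrix_op (\<lambda>n j. \<Sum>k=1..j. m1 n k * m2 k j) f n"
  proof (cases "n = 0")
    case True
    then show ?thesis by (simp add: matrix_op_def column_boundedD(1)[OF m1])
  next
    case False
    have "\<bar>m1 n k\<bar> \<le> K1 / w n * w k" if "1 \<le> k" for k
      using column_bounded_entry[OF m1, of n k] that False w_pos[of n] by (simp add: field_simps)
    from infsum_weighted_matrix_op[OF m2 f this] show ?thesis
      by (simp add: matrix_op_def)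
  qed
qed

text \<open>Dominated convergence over the columns: the norm of the difference is at most the sum
  over \<open>j\<close> of column sum times \<open>cmod (f j)\<close>, each column sum is finite and
  tends to 0, and \<open>M\<close> is a summable majorant. Convergence in the space is thereby
  reduced to single real entries and one column bound common to all parameters.\<close>

lemma limitin_matrix_op:
  assumes f: "f \<in> ell1 w" and m: "\<forall>\<^sub>F x in F. column_bounded (m x) K" and l: "column_bounded l K"
    and lim: "\<And>n j. 1 \<le> n \<Longrightarrow> n \<le> j \<Longrightarrow> ((\<lambda>x. m x n j) \<longlongrightarrow> l n j) F"
  shows "limitin (ell1_top w) (\<lambda>x. matrix_op (m x) f) (matrix_op l f) F"
proof (cases "F = bot")
  \<comment> \<open>Tannery's theorem asks for a nontrivial filter, but
    \<open>at T within {T..T}\<close> does occur.\<close>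
  case True
  then show ?thesis by (simp add: limitin_ell1_iff matrix_op_ell1[OF l f])
next
  case False
  define g where "g j x = (\<Sum>n=1..j. w n * \<bar>m x n j - l n j\<bar>) * cmod (f j)" for j x
  define M where "M j = (K + K) * (w j * cmod (f j))" for j
  have f0: "f 0 = 0" using f by (simp add: ell1_def)
  have diff: "\<forall>\<^sub>F x in F. column_bounded (\<lambda>n j. m x n j - l n j) (K + K)"
    using m by eventually_elim (rule column_bounded_diff[OF _ l])
  have g_nonneg: "0 \<le> g j x" for j x
    unfolding g_def using w_pos by (intro mult_nonneg_nonneg sum_nonneg) (auto simp: less_imp_le)
  have g_le: "\<forall>\<^sub>F x in F. \<forall>j. g j x \<le> M j"
    using diff
  proof eventually_elim
    case (elim x)
    show ?case
    proof
      fix j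
      show "g j x \<le> M j"
      proof (cases "j = 0")
        case False
        then show ?thesis
          using mult_right_mono[OF column_boundedD(2)[OF elim, of j], of "cmod (f j)"]
          by (simp add: g_def M_def mult_ac)
      qed (simp add: g_def M_def f0)
    qed
  qed
  \<comment> \<open>Tannery's theorem speaks of series over all naturals; index 0 contributes
    nothing because \<open>f 0 = 0\<close>.\<close>
  have UN: "h summable_on UNIV \<longleftrightarrow> h summable_on {1..}" "infsum h UNIV = infsum h {1..}"
    if "h 0 = 0" for h :: "nat \<Rightarrow> real"
    by (rule summable_on_cong_neutral infsum_cong_neutral;
        use that in \<open>auto simp: not_le\<close>)+
  have "M summable_on UNIV"
    using summable_on_cmult_right[OF summable_ell1[OF f], of "K + K"]
    by (subst UN) (simp_all add: M_def[abs_def] f0)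
  then have M: "summable M" by (rule summable_on_imp_summable)
  have lim_g: "((\<lambda>x. g j x) \<longlongrightarrow> 0) F" for j
    unfolding g_def
    by (rule tendsto_eq_intros lim LIM_zero refl | simp)+
  have "((\<lambda>x. suminf (\<lambda>j. g j x)) \<longlongrightarrow> suminf (\<lambda>j. 0)) F"
  proof (rule tannerys_theorem[THEN conjunct2, THEN conjunct2])
    show "\<forall>\<^sub>F (j, x) in at_top \<times>\<^sub>F F. norm (g j x) \<le> M j"
      using eventually_prodI[of "\<lambda>_. True" at_top, OF _ g_le]
      by (auto simp: case_prod_unfold g_nonneg elim: eventually_mono)
  qed (use lim_g M False in auto)
  then have lim_g_sum: "((\<lambda>x. suminf (\<lambda>j. g j x)) \<longlongrightarrow> 0) F" by simp
  have le: "\<forall>\<^sub>F x in F. ell1_norm w (\<lambda>n. matrix_op (m x) f n - matrix_op l f n) \<le> suminf (\<lambda>j. g j x)"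
    using m diff
  proof eventually_elim
    case (elim x)
    have sm: "(\<lambda>j. g j x) summable_on UNIV"
      using matrix_op_double_has_sum(1)[OF elim(2) f] by (subst UN) (simp_all add: g_def f0)
    have "ell1_norm w (\<lambda>n. matrix_op (m x) f n - matrix_op l f n)
        = ell1_norm w (matrix_op (\<lambda>n j. m x n j - l n j) f)"
      using matrix_op_diff_quotient[OF elim(1) l f, of 1] by simp
    also have "\<dots> \<le> infsum (\<lambda>j. g j x) {1..}"
      unfolding g_def by (rule matrix_op_ell1(2)[OF elim(2) f])
    also have "\<dots> = infsum (\<lambda>j. g j x) UNIV" by (subst UN) (simp_all add: g_def f0)
    also have "\<dots> = suminf (\<lambda>j. g j x)"
      using sm by (intro infsumI sums_nonneg_imp_has_sum summable_sums summable_on_imp_summable)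
        (auto simp: g_nonneg)
    finally show ?case .
  qed
  have "((\<lambda>x. ell1_norm w (\<lambda>n. matrix_op (m x) f n - matrix_op l f n)) \<longlongrightarrow> 0) F"
    by (rule tendsto_sandwich[OF _ le tendsto_const lim_g_sum]) (simp add: ell1_norm_nonneg)
  moreover have "\<forall>\<^sub>F x in F. matrix_op (m x) f \<in> ell1 w"
    using m by eventually_elim (rule matrix_op_ell1(1)[OF _ f])
  ultimately show ?thesis by (simp add: limitin_ell1_iff matrix_op_ell1[OF l f])
qed

end

section \<open>The propagator of the truncated systems\<close>

lemma sum_strict_triangle_swap:
  fixes g :: "nat \<Rightarrow> nat \<Rightarrow> real"
  shows "(\<Sum>n=1..j. \<Sum>i=n+1..j. g n i) = (\<Sum>i=1..j. \<Sum>n=1..i-1. g n i)"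
proof -
  have "(\<Sum>n=1..j. \<Sum>i=n+1..j. g n i) = (\<Sum>n=1..j. \<Sum>i=1..j. if n < i then g n i else 0)"
    by (intro sum.cong sum.mono_neutral_cong_left) auto
  also have "\<dots> = (\<Sum>i=1..j. \<Sum>n=1..j. if n < i then g n i else 0)"
    by (rule sum.swap)
  also have "\<dots> = (\<Sum>i=1..j. \<Sum>n=1..i-1. g n i)"
    by (intro sum.cong sum.mono_neutral_cong_right) auto
  finally show ?thesis .
qed

text \<open>The identity \<open>p (G x) = (p G) x\<close> for the triangular generator: the right
  side shows the row of the adjoint system, whose bracket has a sign for \<open>p = w\<close> by
  (A4) and is 0 in the mass conserving case for \<open>p n = n\<close> and
  \<open>k \<ge> 2\<close>.\<close>

lemma adjoint_triangular_sum:
  fixes p x \<alpha> :: "nat \<Rightarrow> real" and \<beta> :: "nat \<Rightarrow> nat \<Rightarrow> real"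
  shows "(\<Sum>n=1..j. p n * (- \<alpha> n * x n + (\<Sum>i=n+1..j. \<alpha> i * \<beta> n i * x i)))
    = (\<Sum>k=1..j. \<alpha> k * ((\<Sum>n=1..k-1. p n * \<beta> n k) - p k) * x k)"
proof -
  have "(\<Sum>n=1..j. p n * (- \<alpha> n * x n + (\<Sum>i=n+1..j. \<alpha> i * \<beta> n i * x i)))
      = (\<Sum>n=1..j. p n * (- \<alpha> n * x n)) + (\<Sum>n=1..j. \<Sum>i=n+1..j. p n * (\<alpha> i * \<beta> n i * x i))"
    by (simp only: distrib_left sum.distrib sum_distrib_left)
  also have "\<dots> = (\<Sum>k=1..j. p k * (- \<alpha> k * x k) + (\<Sum>n=1..k-1. p n * (\<alpha> k * \<beta> n k * x k)))"
    unfolding sum_strict_triangle_swap by (rule sum.distrib[symmetric])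
  also have "\<dots> = (\<Sum>k=1..j. \<alpha> k * ((\<Sum>n=1..k-1. p n * \<beta> n k) - p k) * x k)"
    by (intro sum.cong refl) (simp add: algebra_simps sum_distrib_left)
  finally show ?thesis .
qed

text \<open>The hypotheses in the form in which they are applied: (A5) and (A6) with
  \<open>\<tau> = s\<close> and the division cleared, (A4) and (A6) from \<open>j = 1\<close> on,
  where the sum is empty.\<close>

locale fragmentation = weight w for w :: "nat \<Rightarrow> real" +
  fixes T \<kappa> C1 C2 \<sigma> :: real
    and a :: "nat \<Rightarrow> real \<Rightarrow> real"
    and b :: "nat \<Rightarrow> nat \<Rightarrow> real \<Rightarrow> real"
  assumes T: "T > 0"
    and a_nonneg: "\<And>n t. n \<ge> 1 \<Longrightarrow> t \<in> {0..T} \<Longrightarrow> a n t \<ge> 0"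
    and b_nonneg: "\<And>n j t. n \<ge> 1 \<Longrightarrow> j \<ge> 1 \<Longrightarrow> t \<in> {0..T} \<Longrightarrow> b n j t \<ge> 0"
    and b_zero: "\<And>n j t. n \<ge> 1 \<Longrightarrow> j \<ge> 1 \<Longrightarrow> t \<in> {0..T} \<Longrightarrow> j \<le> n \<Longrightarrow> b n j t = 0"
    and kappa: "0 < \<kappa>" "\<kappa> < 1"
    and b_column: "\<And>j t. j \<ge> 1 \<Longrightarrow> t \<in> {0..T} \<Longrightarrow> (\<Sum>n=1..j-1. w n * b n j t) \<le> \<kappa> * w j"
    and constants: "C1 \<ge> 0" "C2 \<ge> 0" "0 < \<sigma>"
    and a_holder: "\<And>n s t. n \<ge> 1 \<Longrightarrow> s \<in> {0..T} \<Longrightarrow> t \<in> {0..T} \<Longrightarrow>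
      \<bar>a n t - a n s\<bar> \<le> C1 * (1 + a n s) * \<bar>t - s\<bar> powr \<sigma>"
    and ab_holder: "\<And>j s t. j \<ge> 1 \<Longrightarrow> s \<in> {0..T} \<Longrightarrow> t \<in> {0..T} \<Longrightarrow>
      (\<Sum>n=1..j-1. w n * \<bar>a j t * b n j t - a j s * b n j s\<bar>) \<le> C2 * w j * (1 + a j s) * \<bar>t - s\<bar> powr \<sigma>"
begin

lemma continuous_a: "n \<ge> 1 \<Longrightarrow> continuous_on {0..T} (a n)"
  by (rule continuous_on_if_Holder[OF constants(3) a_holder])

text \<open>(A6) controls the product; \<open>b n j\<close> alone may be discontinuous where
  \<open>a j\<close> vanishes. For this reason the columns solve systems whose coefficients are the
  products.\<close>

lemma continuous_ab:
  assumes "n \<ge> 1" "j \<ge> 1"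
  shows "continuous_on {0..T} (\<lambda>t. a j t * b n j t)"
proof (cases "n < j")
  case True
  show ?thesis
  proof (rule continuous_on_if_Holder[OF constants(3), where L = "\<lambda>s. C2 * w j * (1 + a j s) / w n"])
    fix s t assume st: "s \<in> {0..T}" "t \<in> {0..T}"
    have "w n * \<bar>a j t * b n j t - a j s * b n j s\<bar>
        \<le> (\<Sum>n=1..j-1. w n * \<bar>a j t * b n j t - a j s * b n j s\<bar>)"
      by (rule member_le_sum[where f = "\<lambda>n. w n * \<bar>a j t * b n j t - a j s * b n j s\<bar>"])
        (use True assms w_pos in \<open>auto simp: less_imp_le\<close>)
    also have "\<dots> \<le> C2 * w j * (1 + a j s) * \<bar>t - s\<bar> powr \<sigma>" using ab_holder assms st by blast
    finally show "\<bar>a j t * b n j t - a j s * b n j s\<bar> \<le> C2 * w j * (1 + a j s) / w n * \<bar>t - s\<bar> powr \<sigma>"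
      using w_pos[of n] assms by (simp add: field_simps)
  qed
next
  case False
  then show ?thesis
    using assms by (intro continuous_on_eq[OF continuous_on_const[of _ 0]]) (auto simp: b_zero)
qed

definition column_system :: "real \<Rightarrow> nat \<Rightarrow> (nat \<Rightarrow> real \<Rightarrow> real) \<Rightarrow> bool" where
  "column_system s j x \<longleftrightarrow> (\<forall>n\<in>{1..j}. x n s = (if n = j then 1 else 0) \<and> (\<forall>t\<in>{s..T}.
     (x n has_real_derivative - a n t * x n t + (\<Sum>i=n+1..j. a i t * b n i t * x i t))
       (at t within {s..T})))"

text \<open>\<open>V t s n j\<close> is the entry \<open>n\<close> at time \<open>t\<close> of the solution that starts at time \<open>s\<close> in the
  unit vector \<open>j\<close>; \<open>VG\<close> is its time derivative.\<close>

definition V :: "real \<Rightarrow> real \<Rightarrow> nat \<Rightarrow> nat \<Rightarrow> real" where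
  "V t s n j = (if 1 \<le> n \<and> n \<le> j then (SOME x. column_system s j x) n t else 0)"

definition VG :: "real \<Rightarrow> real \<Rightarrow> nat \<Rightarrow> nat \<Rightarrow> real" where
  "VG t s n j = (if 1 \<le> n \<and> n \<le> j
     then - a n t * V t s n j + (\<Sum>i=n+1..j. a i t * b n i t * V t s i j) else 0)"

lemma column_system_V:
  assumes "0 \<le> s"
  shows "column_system s j (\<lambda>n t. V t s n j)"
proof -
  have sub: "{s..T} \<subseteq> {0..T}" using assms by auto
  have "\<exists>x. column_system s j x"
    unfolding column_system_def
    using exists_upper_triangular_ode_solution[of j s T a "\<lambda>n i t. a i t * b n i t"
        "\<lambda>n. if n = j then 1 else 0"]
      continuous_on_subset[OF continuous_a sub] continuous_on_subset[OF continuous_ab sub] by simp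
  then have x: "column_system s j (SOME x. column_system s j x)" by (rule someI_ex)
  define x where "x = (SOME x. column_system s j x)"
  have eq: "(\<lambda>t. V t s n j) = x n" "V t s n j = x n t" if "n \<in> {1..j}" for n t
    using that by (auto simp: V_def x_def)
  have eqs: "(\<Sum>i=n+1..j. a i t * b n i t * V t s i j) = (\<Sum>i=n+1..j. a i t * b n i t * x i t)" for n t
    by (intro sum.cong) (auto simp: eq)
  have "column_system s j x" using x by (simp add: x_def)
  then show ?thesis
    unfolding column_system_def eqs by (auto simp: eq)
qed

lemma V_outside [simp]: "V t s 0 j = 0" "j < n \<Longrightarrow> V t s n j = 0"
  by (auto simp: V_def)

lemma VG_outside [simp]: "VG t s 0 j = 0" "j < n \<Longrightarrow> VG t s n j = 0"
  by (auto simp: VG_def)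

lemma V_init: "0 \<le> s \<Longrightarrow> V s s n j = (if n = j \<and> 1 \<le> n then 1 else 0)"
  using column_system_V[of s j] by (cases "1 \<le> n \<and> n \<le> j") (auto simp: column_system_def V_def)

lemma V_deriv:
  assumes "0 \<le> s" "t \<in> {s..T}"
  shows "((\<lambda>t. V t s n j) has_real_derivative VG t s n j) (at t within {s..T})"
proof (cases "1 \<le> n \<and> n \<le> j")
  case True
  then show ?thesis
    using column_system_V[of s j] assms by (auto simp: column_system_def VG_def)
qed (auto simp: V_def VG_def)

lemma V_continuous: "0 \<le> s \<Longrightarrow> continuous_on {s..T} (\<lambda>t. V t s n j)"
  by (rule DERIV_continuous_on[OF V_deriv])

lemma VG_continuous:
  assumes "0 \<le> s"
  shows "continuous_on {s..T} (\<lambda>t. VG t s n j)"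
proof -
  have sub: "{s..T} \<subseteq> {0..T}" using assms by auto
  show ?thesis
  proof (cases "1 \<le> n \<and> n \<le> j")
    case True
    then have "continuous_on {s..T} (\<lambda>t. - a n t * V t s n j + (\<Sum>i=n+1..j. a i t * b n i t * V t s i j))"
      using continuous_on_subset[OF continuous_a sub] continuous_on_subset[OF continuous_ab sub]
      by (intro continuous_on_add continuous_on_sum continuous_on_mult[OF _ V_continuous[OF assms]]
          continuous_on_minus) auto
    with True show ?thesis by (simp add: VG_def)
  next
    case False
    then show ?thesis by (auto simp: VG_def)
  qed
qed

text \<open>Induction on the distance \<open>j - n\<close> to the diagonal: entry \<open>n\<close>
  receives inflow from entries \<open>i > n\<close>, which are already known to be
  nonnegative.\<close>

lemma V_nonneg:
  assumes s: "0 \<le> s" and t: "t \<in> {s..T}"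
  shows "0 \<le> V t s n j"
proof (cases "1 \<le> n \<and> n \<le> j")
  case True
  then show ?thesis using t
  proof (induction "j - n" arbitrary: n t rule: less_induct)
    case less
    show ?case
    proof (rule linear_differential_inequality_nonneg[OF V_deriv[OF s]])
      show "continuous_on {s..T} (a n)"
        using continuous_on_subset[OF continuous_a] less.prems(1) s by auto
      show "0 \<le> V s s n j" using s by (simp add: V_init)
      show "t \<in> {s..T}" by (rule less.prems(2))
      fix r assume r: "r \<in> {s..T}"
      have "0 \<le> (\<Sum>i=n+1..j. a i r * b n i r * V r s i j)"
        using r s less.prems(1) less.hyps a_nonneg b_nonneg
        by (intro sum_nonneg mult_nonneg_nonneg) auto
      then show "- a n r * V r s n j \<le> VG r s n j"
        using less.prems(1) by (simp add: VG_def)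
    qed
  qed
qed (auto simp: V_def)

lemma sum_VG:
  "(\<Sum>n=1..j. p n * VG t s n j)
    = (\<Sum>k=1..j. a k t * ((\<Sum>n=1..k-1. p n * b n k t) - p k) * V t s k j)"
proof -
  have "(\<Sum>n=1..j. p n * VG t s n j)
      = (\<Sum>n=1..j. p n * (- a n t * V t s n j + (\<Sum>i=n+1..j. a i t * b n i t * V t s i j)))"
    by (intro sum.cong) (auto simp: VG_def)
  also have "\<dots> = (\<Sum>k=1..j. a k t * ((\<Sum>n=1..k-1. p n * b n k t) - p k) * V t s k j)"
    by (rule adjoint_triangular_sum)
  finally show ?thesis .
qed

lemma V_sum_deriv:
  assumes "0 \<le> s" "t \<in> {s..T}"
  shows "((\<lambda>t. \<Sum>n=1..j. p n * V t s n j) has_real_derivative (\<Sum>n=1..j. p n * VG t s n j))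
    (at t within {s..T})"
  by (intro DERIV_sum DERIV_cmult V_deriv assms)

lemma V_mass:
  assumes s: "0 \<le> s" and t: "t \<in> {s..T}" and j: "1 \<le> j"
  shows "(\<Sum>n=1..j. w n * V t s n j) \<le> w j"
proof -
  have der: "((\<lambda>t. - (\<Sum>n=1..j. w n * V t s n j)) has_real_derivative - (\<Sum>n=1..j. w n * VG r s n j))
      (at r within {s..t})" if "r \<in> {s..t}" for r
  proof -
    have "((\<lambda>t. \<Sum>n=1..j. w n * V t s n j) has_real_derivative (\<Sum>n=1..j. w n * VG r s n j))
        (at r within {s..T})"
      using V_sum_deriv[OF s] t that by simp
    then have "((\<lambda>t. \<Sum>n=1..j. w n * V t s n j) has_real_derivative (\<Sum>n=1..j. w n * VG r s n j))
        (at r within {s..t})"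
      by (rule DERIV_subset) (use t in auto)
    then show ?thesis by (rule DERIV_minus)
  qed
  have "- (\<Sum>n=1..j. w n * V s s n j) \<le> - (\<Sum>n=1..j. w n * V t s n j)"
  proof (rule mono_from_deriv_within[OF _ DERIV_continuous_on[OF der] der])
    fix r assume r: "r \<in> {s<..<t}"
    have "a k r * ((\<Sum>n=1..k-1. w n * b n k r) - w k) * V r s k j \<le> 0" if k: "k \<in> {1..j}" for k
    proof -
      have "\<kappa> * w k \<le> 1 * w k" using kappa w_pos[of k] k by (intro mult_right_mono) auto
      then have "(\<Sum>n=1..k-1. w n * b n k r) - w k \<le> 0"
        using b_column[of k r] k r s t by auto
      then show ?thesis
        using a_nonneg[of k r] V_nonneg[OF s, of r k j] k r s t
        by (intro mult_nonpos_nonneg mult_nonneg_nonpos) auto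
    qed
    then have "(\<Sum>n=1..j. w n * VG r s n j) \<le> 0"
      unfolding sum_VG by (rule sum_nonpos)
    then show "0 \<le> - (\<Sum>n=1..j. w n * VG r s n j)" by simp
  qed (use t in auto)
  moreover have "(\<Sum>n=1..j. w n * V s s n j) = (\<Sum>n=1..j. if n = j then w n else 0)"
    using s by (intro sum.cong) (auto simp: V_init)
  ultimately show ?thesis using j by simp
qed

lemma column_bounded_V:
  assumes "0 \<le> s" "t \<in> {s..T}"
  shows "column_bounded (V t s) 1"
  unfolding column_bounded_def using V_mass[OF assms] V_nonneg[OF assms] by auto

text \<open>The norm of \<open>A_op a t\<close> applied to column \<open>j\<close>; the smoothing
  estimate is a bound for it.\<close>

definition load :: "real \<Rightarrow> real \<Rightarrow> nat \<Rightarrow> real" where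
  "load t s j = (\<Sum>k=1..j. w k * a k t * V t s k j)"

lemma load_nonneg: "0 \<le> s \<Longrightarrow> t \<in> {s..T} \<Longrightarrow> 0 \<le> load t s j"
  unfolding load_def using a_nonneg w_pos V_nonneg
  by (intro sum_nonneg mult_nonneg_nonneg) (auto simp: less_imp_le)

text \<open>The factor 2 counts loss and gain: by (A4) the gain carries at most the weighted mass
  that the loss removes.\<close>

lemma VG_column_le:
  assumes s: "0 \<le> s" and t: "t \<in> {s..T}"
  shows "(\<Sum>n=1..j. w n * \<bar>VG t s n j\<bar>) \<le> 2 * load t s j"
proof -
  have nn: "0 \<le> w n" "0 \<le> a n t" "0 \<le> V t s n j" if "1 \<le> n" for n
    using w_pos[OF that] a_nonneg[OF that, of t] V_nonneg[OF s t] s t by (auto simp: less_imp_le)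
  have "(\<Sum>n=1..j. w n * \<bar>VG t s n j\<bar>)
      \<le> (\<Sum>n=1..j. w n * (a n t * V t s n j + (\<Sum>i=n+1..j. a i t * b n i t * V t s i j)))"
  proof (intro sum_mono mult_left_mono nn)
    fix n assume n: "n \<in> {1..j}"
    have "0 \<le> (\<Sum>i=n+1..j. a i t * b n i t * V t s i j)"
      using n nn b_nonneg[of n _ t] s t by (intro sum_nonneg mult_nonneg_nonneg) auto
    moreover have "0 \<le> a n t * V t s n j" using n nn by simp
    ultimately show "\<bar>VG t s n j\<bar> \<le> a n t * V t s n j + (\<Sum>i=n+1..j. a i t * b n i t * V t s i j)"
      using n by (simp add: VG_def abs_le_iff)
  qed auto
  also have "\<dots> = (\<Sum>n=1..j. w n * (a n t * V t s n j))
      + (\<Sum>i=1..j. \<Sum>n=1..i-1. w n * (a i t * b n i t * V t s i j))"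
    by (simp only: distrib_left sum.distrib sum_distrib_left sum_strict_triangle_swap)
  also have "(\<Sum>i=1..j. \<Sum>n=1..i-1. w n * (a i t * b n i t * V t s i j))
      = (\<Sum>i=1..j. (\<Sum>n=1..i-1. w n * b n i t) * (a i t * V t s i j))"
    by (simp add: sum_distrib_left sum_distrib_right mult_ac)
  also have "\<dots> \<le> (\<Sum>i=1..j. w i * (a i t * V t s i j))"
  proof (intro sum_mono mult_right_mono)
    fix i assume i: "i \<in> {1..j}"
    have "\<kappa> * w i \<le> 1 * w i" using kappa nn[of i] i by (intro mult_right_mono) auto
    then show "(\<Sum>n=1..i-1. w n * b n i t) \<le> w i" using b_column[of i t] i s t by auto
    show "0 \<le> a i t * V t s i j" using i nn by simp
  qed
  also have "(\<Sum>n=1..j. w n * (a n t * V t s n j)) + (\<Sum>i=1..j. w i * (a i t * V t s i j)) = 2 * load t s j"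
    by (simp add: load_def mult_ac)
  finally show ?thesis by simp
qed

section \<open>The smoothing estimate\<close>

lemma load_le_window:
  assumes s: "0 \<le> s" and m: "s \<le> m" "m < t" and t: "t \<le> T" and j: "1 \<le> j"
    and P: "\<And>r. r \<in> {m<..<t} \<Longrightarrow> load r s j + w j \<le> P"
  shows "(1 - \<kappa>) * load t s j \<le> w j / ((1 - \<kappa>) * (t - m))
    + (C1 + C2) / (1 - \<kappa>) * P * ((t - m) powr \<sigma> / \<sigma>)"
proof -
  have tT: "t \<in> {0..T}" using s m t by auto
  obtain p where p0: "\<And>k. k \<in> {1..j} \<Longrightarrow> p k 0 = a k t * (w k - (\<Sum>n=1..k-1. w n * b n k t))"
    and p': "\<And>k r. k \<in> {1..j} \<Longrightarrow> r \<in> {0..t-m} \<Longrightarrow> (p k has_real_derivative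
        - (a k t * p k r) + a k t * (\<Sum>n=1..k-1. p n r * b n k t)) (at r within {0..t-m})"
    and p_nonneg: "\<And>k r. k \<in> {1..j} \<Longrightarrow> r \<in> {0..t-m} \<Longrightarrow> 0 \<le> p k r"
    and p_le: "\<And>k r. k \<in> {1..j} \<Longrightarrow> r \<in> {0<..t-m} \<Longrightarrow> p k r \<le> w k / ((1 - \<kappa>) * r)"
    by (rule exists_frozen_dissipation_rate[of j "\<lambda>k. a k t" w "\<lambda>n k. b n k t" \<kappa> "t - m"])
      (use a_nonneg b_nonneg w_pos kappa b_column m tT in auto)
  define q where "q k r = p k (t - r)" for k r
  have q': "(q k has_real_derivative a k t * q k r - a k t * (\<Sum>n=1..k-1. q n r * b n k t))
      (at r within {m..t})" if k: "k \<in> {1..j}" and r: "r \<in> {m..t}" for k r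
  proof -
    have "((\<lambda>r. t - r) has_real_derivative -1) (at r within {m..t})"
      by (auto intro!: derivative_eq_intros)
    moreover have "(p k has_real_derivative
        - (a k t * q k r) + a k t * (\<Sum>n=1..k-1. q n r * b n k t)) (at (t - r) within (\<lambda>r. t - r) ` {m..t})"
      unfolding q_def by (rule DERIV_subset[OF p'[OF k]]) (use r in auto)
    ultimately have "(p k \<circ> (\<lambda>r. t - r) has_real_derivative
        (- (a k t * q k r) + a k t * (\<Sum>n=1..k-1. q n r * b n k t)) * -1) (at r within {m..t})"
      by (intro DERIV_image_chain)
    moreover have "p k \<circ> (\<lambda>r. t - r) = q k" by (simp add: q_def fun_eq_iff)
    ultimately show ?thesis by (simp add: algebra_simps)
  qed
  define D where "D r = (\<Sum>k=1..j. q k r * V r s k j)" for r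
  define D' where "D' r = (\<Sum>k=1..j. ((a k t - a k r) * q k r
      + (\<Sum>n=1..k-1. q n r * (a k r * b n k r - a k t * b n k t))) * V r s k j)" for r
  have D: "(D has_real_derivative D' r) (at r within {m..t})" if r: "r \<in> {m..t}" for r
  proof -
    have "(D has_real_derivative (\<Sum>k=1..j. (a k t * q k r - a k t * (\<Sum>n=1..k-1. q n r * b n k t)) * V r s k j
        + VG r s k j * q k r)) (at r within {m..t})"
      unfolding D_def[abs_def]
      by (intro DERIV_sum DERIV_mult q' r DERIV_subset[OF V_deriv[OF s]]) (use r m t in auto)
    also have "(\<Sum>k=1..j. (a k t * q k r - a k t * (\<Sum>n=1..k-1. q n r * b n k t)) * V r s k j
        + VG r s k j * q k r)
      = (\<Sum>k=1..j. (a k t * q k r - a k t * (\<Sum>n=1..k-1. q n r * b n k t)) * V r s k j)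
        + (\<Sum>k=1..j. a k r * ((\<Sum>n=1..k-1. q n r * b n k r) - q k r) * V r s k j)"
      unfolding sum.distrib sum_VG[of "\<lambda>k. q k r", symmetric] by (simp add: mult.commute)
    also have "\<dots> = D' r"
      unfolding D'_def sum.distrib[symmetric]
      by (intro sum.cong refl) (simp add: algebra_simps sum_distrib_left sum_subtractf)
    finally show ?thesis .
  qed
  have D'_le: "D' r \<le> (C1 + C2) / (1 - \<kappa>) * P * (t - r) powr (\<sigma> - 1)" if r: "r \<in> {m<..<t}" for r
  proof -
    \<comment> \<open>Decay factor of \<open>q\<close> times Hoelder factor, which is
      \<open>(t - r) powr (\<sigma> - 1) / (1 - \<kappa>)\<close>.\<close>
    define c where "c = (t - r) powr \<sigma> / ((1 - \<kappa>) * (t - r))"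
    have c: "0 \<le> c" using r kappa by (simp add: c_def)
    have rT: "r \<in> {0..T}" "r \<in> {s..T}" using r s m t by auto
    have "D' r \<le> (\<Sum>k=1..j. c * (C1 + C2) * (w k * (1 + a k r)) * V r s k j)"
      unfolding D'_def
    proof (intro sum_mono mult_right_mono V_nonneg s rT)
      fix k assume k: "k \<in> {1..j}"
      have q_bd: "0 \<le> q n r" "q n r \<le> w n / ((1 - \<kappa>) * (t - r))" if "n \<in> {1..j}" for n
        using p_nonneg[OF that, of "t - r"] p_le[OF that, of "t - r"] r by (auto simp: q_def)
      have "(a k t - a k r) * q k r \<le> \<bar>a k t - a k r\<bar> * q k r"
        using q_bd[OF k] by (intro mult_right_mono) auto
      \<comment> \<open>The base point is \<open>r\<close>, not \<open>t\<close>: the factor must be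
        \<open>1 + a k r\<close> for the error to be measured by the load at the running
        time.\<close>
      also have "\<dots> \<le> (C1 * (1 + a k r) * \<bar>t - r\<bar> powr \<sigma>) * (w k / ((1 - \<kappa>) * (t - r)))"
        using a_holder[of k r t] k rT tT q_bd[OF k] by (intro mult_mono) auto
      also have "\<dots> = c * C1 * (w k * (1 + a k r))" using r by (simp add: c_def)
      finally have 1: "(a k t - a k r) * q k r \<le> c * C1 * (w k * (1 + a k r))" .
      have "(\<Sum>n=1..k-1. q n r * (a k r * b n k r - a k t * b n k t))
          \<le> (\<Sum>n=1..k-1. w n / ((1 - \<kappa>) * (t - r)) * \<bar>a k t * b n k t - a k r * b n k r\<bar>)"
      proof (rule sum_mono)
        fix n assume "n \<in> {1..k-1}"
        then have n: "n \<in> {1..j}" using k by auto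
        have "q n r * (a k r * b n k r - a k t * b n k t) \<le> q n r * \<bar>a k t * b n k t - a k r * b n k r\<bar>"
          using q_bd[OF n] by (intro mult_left_mono) auto
        also have "\<dots> \<le> w n / ((1 - \<kappa>) * (t - r)) * \<bar>a k t * b n k t - a k r * b n k r\<bar>"
          using q_bd[OF n] by (intro mult_right_mono) auto
        finally show "q n r * (a k r * b n k r - a k t * b n k t)
            \<le> w n / ((1 - \<kappa>) * (t - r)) * \<bar>a k t * b n k t - a k r * b n k r\<bar>" .
      qed
      also have "\<dots> = 1 / ((1 - \<kappa>) * (t - r)) * (\<Sum>n=1..k-1. w n * \<bar>a k t * b n k t - a k r * b n k r\<bar>)"
        by (simp add: sum_divide_distrib)
      also have "\<dots> \<le> 1 / ((1 - \<kappa>) * (t - r)) * (C2 * w k * (1 + a k r) * \<bar>t - r\<bar> powr \<sigma>)"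
        using ab_holder[of k r t] k rT tT r kappa by (intro mult_left_mono) auto
      also have "\<dots> = c * C2 * (w k * (1 + a k r))" using r by (simp add: c_def)
      finally have 2: "(\<Sum>n=1..k-1. q n r * (a k r * b n k r - a k t * b n k t))
          \<le> c * C2 * (w k * (1 + a k r))" .
      show "(a k t - a k r) * q k r + (\<Sum>n=1..k-1. q n r * (a k r * b n k r - a k t * b n k t))
          \<le> c * (C1 + C2) * (w k * (1 + a k r))"
        using 1 2 by (simp add: algebra_simps)
    qed
    also have "\<dots> = c * (C1 + C2) * (load r s j + (\<Sum>k=1..j. w k * V r s k j))"
      by (simp add: load_def sum_distrib_left sum.distrib[symmetric] algebra_simps)
    also have "\<dots> \<le> c * (C1 + C2) * P"
      using P[OF r] V_mass[OF s rT(2) j] c constants by (intro mult_left_mono) auto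
    also have "\<dots> = (C1 + C2) / (1 - \<kappa>) * P * (t - r) powr (\<sigma> - 1)"
      using r kappa by (simp add: c_def powr_diff)
    finally show ?thesis .
  qed
  define c where "c = (C1 + C2) / (1 - \<kappa>) * P"
  \<comment> \<open>This integrates the bound on \<open>D'\<close>. The antiderivative of the kernel
    is continuous up to \<open>r = t\<close>, where the kernel itself blows up if
    \<open>\<sigma> < 1\<close>; hence derivatives are compared in the open interval.\<close>
  have "c * (- ((t - m) powr \<sigma> / \<sigma>)) - D m \<le> c * (- ((t - t) powr \<sigma> / \<sigma>)) - D t"
  proof (rule mono_from_deriv_within[where f = "\<lambda>r. c * (- ((t - r) powr \<sigma> / \<sigma>)) - D r"])
    show "m \<le> t" using m by simp
    show "continuous_on {m..t} (\<lambda>r. c * (- ((t - r) powr \<sigma> / \<sigma>)) - D r)"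
      using constants DERIV_continuous_on[OF D]
      by (intro continuous_intros continuous_on_powr') auto
  next
    fix r assume r: "r \<in> {m<..<t}"
    have "((\<lambda>r. c * (- ((t - r) powr \<sigma> / \<sigma>))) has_real_derivative c * (t - r) powr (\<sigma> - 1))
        (at r within {m..t})"
      using r constants by (auto intro!: derivative_eq_intros)
    then show "((\<lambda>r. c * (- ((t - r) powr \<sigma> / \<sigma>)) - D r) has_real_derivative
        c * (t - r) powr (\<sigma> - 1) - D' r) (at r within {m..t})"
      by (rule DERIV_diff[OF _ D]) (use r in auto)
    show "0 \<le> c * (t - r) powr (\<sigma> - 1) - D' r" using D'_le[OF r] by (simp add: c_def)
  qed
  then have "D t \<le> D m + c * ((t - m) powr \<sigma> / \<sigma>)" by simp
  also have "D m \<le> (\<Sum>k=1..j. w k / ((1 - \<kappa>) * (t - m)) * V m s k j)"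
    unfolding D_def using p_le m t
    by (intro sum_mono mult_right_mono V_nonneg s) (auto simp: q_def)
  also have "\<dots> = 1 / ((1 - \<kappa>) * (t - m)) * (\<Sum>k=1..j. w k * V m s k j)"
    by (simp add: sum_divide_distrib)
  also have "\<dots> \<le> 1 / ((1 - \<kappa>) * (t - m)) * w j"
    using V_mass[OF s _ j, of m] m t kappa by (intro mult_left_mono) auto
  finally have "D t \<le> w j / ((1 - \<kappa>) * (t - m)) + c * ((t - m) powr \<sigma> / \<sigma>)" by simp
  moreover have "(1 - \<kappa>) * load t s j \<le> D t"
    unfolding load_def D_def sum_distrib_left
  proof (rule sum_mono)
    fix k assume k: "k \<in> {1..j}"
    have "(1 - \<kappa>) * w k \<le> w k - (\<Sum>n=1..k-1. w n * b n k t)"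
      using b_column[of k t] k tT by (simp add: algebra_simps)
    then have "(1 - \<kappa>) * w k * (a k t * V t s k j) \<le> (w k - (\<Sum>n=1..k-1. w n * b n k t)) * (a k t * V t s k j)"
      using a_nonneg[of k t] V_nonneg[OF s, of t k j] k tT m t by (intro mult_right_mono) auto
    then show "(1 - \<kappa>) * (w k * a k t * V t s k j) \<le> q k t * V t s k j"
      using p0[OF k] by (simp add: q_def mult_ac)
  qed
  ultimately show ?thesis by (simp add: c_def)
qed

text \<open>Let \<open>\<Phi>\<close> be the maximum of \<open>(r - s) * (load r s j + w j)\<close>,
  attained at \<open>r0\<close>, and \<open>d = r0 - s\<close>. On a window before \<open>r0\<close>
  of length \<open>\<eta> * d\<close> the load is at most \<open>2 * \<Phi> / d\<close>, and
  \<open>load_le_window\<close> then bounds \<open>\<Phi>\<close> by a multiple of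
  \<open>w j\<close> plus \<open>\<Phi> / 2\<close>. A window proportional to \<open>d\<close> is
  what keeps the constant free of \<open>s\<close> and \<open>j\<close>.\<close>

lemma exists_load_bound:
  obtains K where "K \<ge> 0"
    "\<And>s t j. 0 \<le> s \<Longrightarrow> s < t \<Longrightarrow> t \<le> T \<Longrightarrow> 1 \<le> j \<Longrightarrow> load t s j \<le> K / (t - s) * w j"
proof -
  define M where "M = 1 / (1 - \<kappa>)"
  have M: "M > 0" using kappa by (simp add: M_def)
  \<comment> \<open>\<open>L * \<eta> powr \<sigma>\<close> will be the coefficient of
    \<open>\<Phi>\<close> in the window estimate, after multiplication by \<open>M * d\<close> and
    with \<open>d powr \<sigma> \<le> T powr \<sigma>\<close>. The second bound in
    \<open>\<eta>\<close> makes it at most 1/2; \<open>\<eta> \<le> 1/2\<close> keeps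
    \<open>r - s \<ge> d / 2\<close> on the window. The summand 1 in \<open>L + 1\<close> covers
    \<open>L = 0\<close>.\<close>
  define L where "L = 2 * M\<^sup>2 * (C1 + C2) * T powr \<sigma> / \<sigma>"
  have L: "L \<ge> 0" using M constants by (simp add: L_def)
  define \<eta> where "\<eta> = min (1/2) ((1 / (2 * (L + 1))) powr (1 / \<sigma>))"
  have \<eta>: "0 < \<eta>" "\<eta> \<le> 1/2" using L by (auto simp: \<eta>_def)
  have "\<eta> powr \<sigma> \<le> ((1 / (2 * (L + 1))) powr (1 / \<sigma>)) powr \<sigma>"
    using \<eta> constants by (intro powr_mono2) (auto simp: \<eta>_def)
  also have "\<dots> = 1 / (2 * (L + 1))" using constants L by (simp add: powr_powr)
  finally have "\<eta> powr \<sigma> * L \<le> 1 / (2 * (L + 1)) * L" using L by (rule mult_right_mono)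
  also have "\<dots> \<le> 1 / 2" using L by (simp add: field_simps)
  finally have \<eta>L: "\<eta> powr \<sigma> * L \<le> 1 / 2" .
  define K where "K = 2 * (M\<^sup>2 / \<eta> + T)"
  have "K \<ge> 0" using \<eta> T by (simp add: K_def)
  moreover have "load t s j \<le> K / (t - s) * w j"
    if s: "0 \<le> s" and st: "s < t" and t: "t \<le> T" and j: "1 \<le> j" for s t j
  proof -
    have wj: "w j > 0" using w_pos j by blast
    have cont: "continuous_on {s..T} (\<lambda>r. load r s j)"
      unfolding load_def using s continuous_on_subset[OF continuous_a, of _ "{s..T}"]
      by (intro continuous_intros V_continuous) auto
    have "continuous_on {s..T} (\<lambda>r. (r - s) * (load r s j + w j))"
      by (intro continuous_intros cont)
    moreover have "{s..T} \<noteq> {}" using st t by simp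
    ultimately have "\<exists>r0\<in>{s..T}. \<forall>r\<in>{s..T}.
        (r - s) * (load r s j + w j) \<le> (r0 - s) * (load r0 s j + w j)"
      by (intro continuous_attains_sup[OF compact_Icc])
    then obtain r0 where r0: "r0 \<in> {s..T}"
      and max: "\<And>r. r \<in> {s..T} \<Longrightarrow> (r - s) * (load r s j + w j) \<le> (r0 - s) * (load r0 s j + w j)"
      by blast
    define \<Phi> where "\<Phi> = (r0 - s) * (load r0 s j + w j)"
    have \<Phi>0: "\<Phi> \<ge> 0"
      using r0 load_nonneg[OF s r0, of j] wj by (simp add: \<Phi>_def)
    have "\<Phi> \<le> K * w j"
    proof (cases "r0 = s")
      case True
      then show ?thesis using \<open>K \<ge> 0\<close> wj by (simp add: \<Phi>_def)
    next
      case False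
      define d where "d = r0 - s"
      have d: "0 < d" "d \<le> T" using False r0 s by (auto simp: d_def)
      define m where "m = r0 - \<eta> * d"
      have "\<eta> * d \<le> 1/2 * d" using \<eta> d by (intro mult_right_mono) auto
      then have m: "s \<le> m" "m < r0" "d / 2 \<le> m - s"
        using mult_pos_pos[OF \<eta>(1) d(1)] d_def by (simp_all add: m_def)
      have "load r s j + w j \<le> 2 * \<Phi> / d" if r: "r \<in> {m<..<r0}" for r
      proof -
        have "d / 2 * (load r s j + w j) \<le> (r - s) * (load r s j + w j)"
          using load_nonneg[OF s, of r j] wj r m r0 by (intro mult_right_mono) auto
        also have "\<dots> \<le> \<Phi>" unfolding \<Phi>_def by (rule max) (use r m r0 in auto)
        finally show ?thesis using d by (simp add: field_simps)
      qed
      from load_le_window[OF s m(1,2) _ j this]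
      have "(1 - \<kappa>) * load r0 s j \<le> w j / ((1 - \<kappa>) * (r0 - m))
          + (C1 + C2) / (1 - \<kappa>) * (2 * \<Phi> / d) * ((r0 - m) powr \<sigma> / \<sigma>)"
        using r0 by auto
      also have "r0 - m = \<eta> * d" by (simp add: m_def)
      finally have "(1 - \<kappa>) * load r0 s j \<le> w j / ((1 - \<kappa>) * (\<eta> * d))
          + (C1 + C2) / (1 - \<kappa>) * (2 * \<Phi> / d) * ((\<eta> * d) powr \<sigma> / \<sigma>)" .
      then have "(M * d) * ((1 - \<kappa>) * load r0 s j) \<le> (M * d) * (w j / ((1 - \<kappa>) * (\<eta> * d))
          + (C1 + C2) / (1 - \<kappa>) * (2 * \<Phi> / d) * ((\<eta> * d) powr \<sigma> / \<sigma>))"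
        using M d by (intro mult_left_mono) auto
      also have "(M * d) * ((1 - \<kappa>) * load r0 s j) = d * load r0 s j"
        using kappa by (simp add: M_def)
      also have "(M * d) * (w j / ((1 - \<kappa>) * (\<eta> * d))
          + (C1 + C2) / (1 - \<kappa>) * (2 * \<Phi> / d) * ((\<eta> * d) powr \<sigma> / \<sigma>))
          = M\<^sup>2 / \<eta> * w j + 2 * M\<^sup>2 * (C1 + C2) / \<sigma> * \<Phi> * (\<eta> powr \<sigma> * d powr \<sigma>)"
      proof -
        have "(M * d) * (w j / ((1 - \<kappa>) * (\<eta> * d))) = M\<^sup>2 / \<eta> * w j"
          using d by (simp add: M_def power2_eq_square)
        moreover have "(M * d) * ((C1 + C2) / (1 - \<kappa>) * (2 * \<Phi> / d) * ((\<eta> * d) powr \<sigma> / \<sigma>))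
            = 2 * M\<^sup>2 * (C1 + C2) / \<sigma> * \<Phi> * (\<eta> powr \<sigma> * d powr \<sigma>)"
          using d \<eta> by (simp add: M_def power2_eq_square powr_mult mult_ac del: distrib_left_numeral)
        ultimately show ?thesis by (simp only: distrib_left)
      qed
      also have "\<dots> \<le> M\<^sup>2 / \<eta> * w j + 2 * M\<^sup>2 * (C1 + C2) / \<sigma> * \<Phi> * (\<eta> powr \<sigma> * T powr \<sigma>)"
        using d \<Phi>0 M constants by (intro add_left_mono mult_left_mono powr_mono2) auto
      also have "\<dots> = M\<^sup>2 / \<eta> * w j + \<Phi> * (\<eta> powr \<sigma> * L)" by (simp add: L_def)
      also have "\<dots> \<le> M\<^sup>2 / \<eta> * w j + \<Phi> * (1 / 2)"
        using \<eta>L \<Phi>0 by (intro add_left_mono mult_left_mono) auto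
      finally have "d * load r0 s j \<le> M\<^sup>2 / \<eta> * w j + \<Phi> / 2" by simp
      moreover have "d * w j \<le> T * w j" using d wj by (intro mult_right_mono) auto
      moreover have "\<Phi> = d * load r0 s j + d * w j" by (simp add: \<Phi>_def d_def distrib_left)
      ultimately have "\<Phi> \<le> M\<^sup>2 / \<eta> * w j + \<Phi> / 2 + T * w j" by simp
      then have "\<Phi> \<le> 2 * (M\<^sup>2 / \<eta> * w j + T * w j)" by simp
      then show ?thesis by (simp add: K_def distrib_right)
    qed
    moreover have "(t - s) * load t s j \<le> (t - s) * (load t s j + w j)"
      using st wj by (intro mult_left_mono) auto
    moreover have "(t - s) * (load t s j + w j) \<le> \<Phi>"
      unfolding \<Phi>_def by (rule max) (use st t in auto)
    ultimately have "(t - s) * load t s j \<le> K * w j"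
      by linarith
    then show ?thesis using st by (simp add: field_simps)
  qed
  ultimately show ?thesis by (rule that)
qed

section \<open>Column bounds away from the initial time, uniform in the column\<close>

definition load_const :: real where
  "load_const = (SOME K. K \<ge> 0 \<and> (\<forall>s t j. 0 \<le> s \<longrightarrow> s < t \<longrightarrow> t \<le> T \<longrightarrow> 1 \<le> j \<longrightarrow>
     load t s j \<le> K / (t - s) * w j))"

lemma load_const_nonneg: "0 \<le> load_const"
  and load_le: "0 \<le> s \<Longrightarrow> s < t \<Longrightarrow> t \<le> T \<Longrightarrow> 1 \<le> j \<Longrightarrow> load t s j \<le> load_const / (t - s) * w j"
proof -
  have "\<exists>K. K \<ge> 0 \<and> (\<forall>s t j. 0 \<le> s \<longrightarrow> s < t \<longrightarrow> t \<le> T \<longrightarrow> 1 \<le> j \<longrightarrow>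
     load t s j \<le> K / (t - s) * w j)"
    using exists_load_bound by metis
  from someI_ex[OF this, folded load_const_def] show "0 \<le> load_const"
    and "0 \<le> s \<Longrightarrow> s < t \<Longrightarrow> t \<le> T \<Longrightarrow> 1 \<le> j \<Longrightarrow> load t s j \<le> load_const / (t - s) * w j"
    by auto
qed

lemma column_bounded_aV:
  assumes "0 \<le> s" "s < t" "t \<le> T"
  shows "column_bounded (\<lambda>n j. a n t * V t s n j) (load_const / (t - s))"
  unfolding column_bounded_def
proof (intro conjI allI impI)
  fix j :: nat assume j: "1 \<le> j"
  have "(\<Sum>n=1..j. w n * \<bar>a n t * V t s n j\<bar>) = load t s j"
    unfolding load_def using assms a_nonneg V_nonneg
    by (intro sum.cong refl) (simp add: abs_mult)
  then show "(\<Sum>n=1..j. w n * \<bar>a n t * V t s n j\<bar>) \<le> load_const / (t - s) * w j"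
    using load_le[OF assms j] by simp
qed auto

lemma column_bounded_VG:
  assumes "0 \<le> s" "s < t" "t \<le> T"
  shows "column_bounded (VG t s) (2 * load_const / (t - s))"
  unfolding column_bounded_def
proof (intro conjI allI impI)
  fix j :: nat assume j: "1 \<le> j"
  have "(\<Sum>n=1..j. w n * \<bar>VG t s n j\<bar>) \<le> 2 * load t s j"
    using VG_column_le[of s t j] assms by simp
  also have "\<dots> \<le> 2 * (load_const / (t - s) * w j)"
    using load_le[OF assms j] by simp
  finally show "(\<Sum>n=1..j. w n * \<bar>VG t s n j\<bar>) \<le> 2 * load_const / (t - s) * w j"
    by simp
qed auto

text \<open>Testing with the signs of the whole increment turns its l1 norm into the increment of
  one linear functional \<open>h\<close>. The weights of \<open>h\<close> are at most
  \<open>w n\<close> in modulus, so its derivative is at most \<open>2 * load x s j\<close> and the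
  mean value inequality applies.\<close>

lemma V_increment:
  assumes s: "0 \<le> s" and sub: "{c..d} \<subseteq> {s..T}"
    and B: "\<And>x. x \<in> {c..d} \<Longrightarrow> 2 * load x s j \<le> B"
    and rt: "r \<in> {c..d}" "t \<in> {c..d}"
  shows "(\<Sum>n=1..j. w n * \<bar>V r s n j - V t s n j\<bar>) \<le> B * \<bar>r - t\<bar>"
proof -
  define \<epsilon> where "\<epsilon> n = sgn (V r s n j - V t s n j)" for n
  define h where "h x = (\<Sum>n=1..j. (w n * \<epsilon> n) * V x s n j)" for x
  have "norm (h r - h t) \<le> B * norm (r - t)"
  proof (rule field_differentiable_bound[OF convex_real_interval(5) _ _ rt])
    fix x assume x: "x \<in> {c..d}"
    have "(h has_real_derivative (\<Sum>n=1..j. (w n * \<epsilon> n) * VG x s n j)) (at x within {s..T})"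
      unfolding h_def[abs_def] by (rule V_sum_deriv[OF s]) (use x sub in auto)
    then show "(h has_real_derivative (\<Sum>n=1..j. (w n * \<epsilon> n) * VG x s n j)) (at x within {c..d})"
      by (rule DERIV_subset[OF _ sub])
    have "\<bar>\<Sum>n=1..j. (w n * \<epsilon> n) * VG x s n j\<bar> \<le> (\<Sum>n=1..j. \<bar>(w n * \<epsilon> n) * VG x s n j\<bar>)"
      by (rule sum_abs)
    also have "\<dots> \<le> (\<Sum>n=1..j. w n * \<bar>VG x s n j\<bar>)"
    proof (rule sum_mono)
      fix n assume "n \<in> {1..j}"
      then have "0 < w n" using w_pos by simp
      moreover have "\<bar>\<epsilon> n\<bar> \<le> 1" by (simp add: \<epsilon>_def sgn_if)
      ultimately have "w n * \<bar>\<epsilon> n\<bar> \<le> w n * 1" by (intro mult_left_mono) auto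
      then show "\<bar>(w n * \<epsilon> n) * VG x s n j\<bar> \<le> w n * \<bar>VG x s n j\<bar>"
        using \<open>0 < w n\<close> by (simp add: abs_mult mult_right_mono)
    qed
    also have "\<dots> \<le> 2 * load x s j" using VG_column_le[OF s] x sub by auto
    also have "\<dots> \<le> B" by (rule B[OF x])
    finally show "norm (\<Sum>n=1..j. (w n * \<epsilon> n) * VG x s n j) \<le> B" by simp
  qed
  moreover have "h r - h t = (\<Sum>n=1..j. w n * \<bar>V r s n j - V t s n j\<bar>)"
    unfolding h_def sum_subtractf[symmetric]
    by (intro sum.cong refl) (simp add: \<epsilon>_def abs_sgn algebra_simps)
  ultimately show ?thesis by auto
qed

text \<open>The domination for differentiating under the sum; the intermediate time \<open>c\<close>
  keeps clear of the singularity of the smoothing estimate at \<open>s\<close>.\<close>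

lemma column_bounded_V_quotient:
  assumes s: "0 \<le> s" "s < c" and r: "r \<in> {c..T}" "r \<noteq> t" and t: "t \<in> {c..T}"
  shows "column_bounded (\<lambda>n j. (V r s n j - V t s n j) / (r - t)) (2 * load_const / (c - s))"
  unfolding column_bounded_def
proof (intro conjI allI impI)
  fix j :: nat assume j: "1 \<le> j"
  have "2 * load x s j \<le> 2 * load_const / (c - s) * w j" if x: "x \<in> {c..T}" for x
  proof -
    have "load_const / (x - s) \<le> load_const / (c - s)"
      using x s load_const_nonneg by (intro divide_left_mono mult_pos_pos) auto
    then have "load_const / (x - s) * w j \<le> load_const / (c - s) * w j"
      using w_pos[OF j] by (intro mult_right_mono) auto
    then show ?thesis using load_le[of s x j] x s j by simp
  qed
  from V_increment[OF s(1) _ this r(1) t]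
  have "(\<Sum>n=1..j. w n * \<bar>V r s n j - V t s n j\<bar>) \<le> 2 * load_const / (c - s) * w j * \<bar>r - t\<bar>"
    using s by auto
  moreover have "(\<Sum>n=1..j. w n * \<bar>(V r s n j - V t s n j) / (r - t)\<bar>)
      = (\<Sum>n=1..j. w n * \<bar>V r s n j - V t s n j\<bar>) / \<bar>r - t\<bar>"
    by (simp add: sum_divide_distrib)
  ultimately show "(\<Sum>n=1..j. w n * \<bar>(V r s n j - V t s n j) / (r - t)\<bar>) \<le> 2 * load_const / (c - s) * w j"
    using r(2) by (simp add: pos_divide_le_eq)
qed auto

section \<open>The generators\<close>

text \<open>\<open>B(t)\<close> with the rates taken out: \<open>B(t) f\<close> is this matrix
  applied to \<open>a f\<close>. By (A4) it is bounded with norm at most \<open>\<kappa>\<close>,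
  although \<open>B(t)\<close> may be unbounded.\<close>

definition gain :: "real \<Rightarrow> nat \<Rightarrow> nat \<Rightarrow> real" where
  "gain t n j = (if 1 \<le> n \<and> n < j then b n j t else 0)"

lemma column_bounded_gain:
  assumes "t \<in> {0..T}"
  shows "column_bounded (gain t) \<kappa>"
  unfolding column_bounded_def
proof (intro conjI allI impI)
  fix j :: nat assume j: "1 \<le> j"
  have "(\<Sum>n=1..j. w n * \<bar>gain t n j\<bar>) = (\<Sum>n=1..j-1. w n * b n j t)"
    using assms b_nonneg[OF _ j] by (intro sum.mono_neutral_cong_right) (auto simp: gain_def)
  then show "(\<Sum>n=1..j. w n * \<bar>gain t n j\<bar>) \<le> \<kappa> * w j"
    using b_column[OF j assms] by simp
qed (auto simp: gain_def)

lemma B_op_eq_matrix_op: "B_op a b t f = matrix_op (gain t) (\<lambda>j. complex_of_real (a j t) * f j)"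
proof
  fix n
  show "B_op a b t f n = matrix_op (gain t) (\<lambda>j. complex_of_real (a j t) * f j) n"
  proof (cases "n = 0")
    case False
    then have "matrix_op (gain t) (\<lambda>j. complex_of_real (a j t) * f j) n
        = (\<Sum>\<^sub>\<infinity>j\<in>{n+1..}. complex_of_real (a j t * b n j t) * f j)"
      unfolding matrix_op_def by (intro infsum_cong_neutral) (auto simp: gain_def mult_ac)
    with False show ?thesis by (simp add: B_op_def)
  qed (simp add: B_op_def matrix_op_def gain_def)
qed

text \<open>Membership in the domain is the smoothing estimate, as the columns of \<open>a V\<close>
  are bounded for \<open>t > s\<close>. The gain term is a product of the two bounded matrices
  \<open>gain t\<close> and \<open>a V\<close>, so the unbounded \<open>B(t)\<close> never has to be
  exchanged with a sum.\<close>

lemma G_op_matrix_op_V: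
  assumes s: "0 \<le> s" "s < t" "t \<le> T" and f: "f \<in> ell1 w"
  shows "matrix_op (V t s) f \<in> A_dom w a t" "G_op a b t (matrix_op (V t s) f) = matrix_op (VG t s) f"
proof -
  have t: "t \<in> {0..T}" using s by auto
  note cV = column_bounded_V[of s t] and caV = column_bounded_aV[OF s] and cVG = column_bounded_VG[OF s]
  have aV: "(\<lambda>n. complex_of_real (a n t) * matrix_op (V t s) f n) = matrix_op (\<lambda>n j. a n t * V t s n j) f"
    by (rule matrix_op_row_scale[symmetric])
  show "matrix_op (V t s) f \<in> A_dom w a t"
    using matrix_op_ell1(1)[OF caV f, folded aV] matrix_op_ell1(1)[OF cV f] s by (simp add: A_dom_def)
  have entry: "(\<Sum>k=1..j. gain t n k * (a k t * V t s k j)) = VG t s n j + a n t * V t s n j" for n j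
  proof (cases "1 \<le> n \<and> n \<le> j")
    case True
    then have "(\<Sum>k=1..j. gain t n k * (a k t * V t s k j)) = (\<Sum>k=n+1..j. a k t * b n k t * V t s k j)"
      by (intro sum.mono_neutral_cong_right) (auto simp: gain_def)
    with True show ?thesis by (simp add: VG_def)
  next
    case False
    then show ?thesis by (auto simp: gain_def VG_def V_def)
  qed
  have "matrix_op (gain t) (matrix_op (\<lambda>n j. a n t * V t s n j) f) = matrix_op (\<lambda>n j. VG t s n j + a n t * V t s n j) f"
    by (simp only: matrix_op_compose[OF column_bounded_gain[OF t] caV f] entry)
  moreover have "matrix_op (\<lambda>n j. VG t s n j + a n t * V t s n j) f n
      = matrix_op (VG t s) f n + matrix_op (\<lambda>n j. a n t * V t s n j) f n" for n
    using infsum_add[OF matrix_op_row_summable[OF cVG f, of n] matrix_op_row_summable[OF caV f, of n]]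
    by (simp add: matrix_op_def distrib_right)
  ultimately have "matrix_op (gain t) (matrix_op (\<lambda>n j. a n t * V t s n j) f) n
      = matrix_op (VG t s) f n + matrix_op (\<lambda>n j. a n t * V t s n j) f n" for n
    by simp
  then show "G_op a b t (matrix_op (V t s) f) = matrix_op (VG t s) f"
    unfolding G_op_def A_op_def B_op_eq_matrix_op aV
    by (simp add: fun_eq_iff aV[THEN fun_cong])
qed

lemma A_domD:
  assumes "f \<in> A_dom w a t"
  shows "f \<in> ell1 w" "(\<lambda>n. complex_of_real (a n t) * f n) \<in> ell1 w"
  using assms by (auto simp: A_dom_def)

lemma G_op_ell1:
  assumes t: "t \<in> {0..T}" and f: "f \<in> A_dom w a t"
  shows "G_op a b t f \<in> ell1 w"
proof -
  note af = A_domD(2)[OF f]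
  have "A_op a t f \<in> ell1 w"
    using ell1_scale(1)[OF af, of "-1"] by (simp add: A_op_def)
  then show ?thesis
    unfolding G_op_def B_op_eq_matrix_op
    by (rule ell1_add(1)[OF _ matrix_op_ell1(1)[OF column_bounded_gain[OF t] af]])
qed

lemma G_op_diff:
  assumes t: "t \<in> {0..T}" and f: "f \<in> A_dom w a t" and g: "g \<in> A_dom w a t"
  shows "(\<lambda>n. f n - g n) \<in> A_dom w a t"
    and "G_op a b t (\<lambda>n. f n - g n) = (\<lambda>n. G_op a b t f n - G_op a b t g n)"
proof -
  note af = A_domD(2)[OF f] and ag = A_domD(2)[OF g]
  have eq: "(\<lambda>n. complex_of_real (a n t) * (f n - g n))
      = (\<lambda>n. complex_of_real (a n t) * f n + -1 * (complex_of_real (a n t) * g n))"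
    by (simp add: algebra_simps)
  have "(\<lambda>n. complex_of_real (a n t) * (f n - g n)) \<in> ell1 w"
    unfolding eq by (rule ell1_add(1)[OF af ell1_scale(1)[OF ag]])
  then show "(\<lambda>n. f n - g n) \<in> A_dom w a t"
    using ell1_diff'[OF _ A_domD(1)[OF f] A_domD(1)[OF g]] by (simp add: A_dom_def)
  show "G_op a b t (\<lambda>n. f n - g n) = (\<lambda>n. G_op a b t f n - G_op a b t g n)"
    unfolding G_op_def A_op_def B_op_eq_matrix_op eq
      matrix_op_add[OF column_bounded_gain[OF t] af ell1_scale(1)[OF ag]] matrix_op_cmult
    by (simp add: algebra_simps)
qed

text \<open>With \<open>g = a f\<close>, the norm of \<open>f + h g\<close> is exactly that of
  \<open>f\<close> plus \<open>h\<close> times that of \<open>g\<close>, because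
  \<open>1 + h * a n t\<close> is a nonnegative multiplier; the gain can take back at most
  \<open>h * \<kappa>\<close> times the norm of \<open>g\<close>. Only moduli enter, so complex
  sequences are covered.\<close>

lemma G_op_dissipative:
  assumes t: "t \<in> {0..T}" and f: "f \<in> A_dom w a t" and h: "0 \<le> h"
  shows "ell1_norm w f \<le> ell1_norm w (\<lambda>n. f n - complex_of_real h * G_op a b t f n)"
proof -
  define g where "g n = complex_of_real (a n t) * f n" for n
  have g: "g \<in> ell1 w" and f': "f \<in> ell1 w" using A_domD[OF f] by (simp_all add: g_def[abs_def])
  define B where "B = matrix_op (gain t) g"
  have B: "B \<in> ell1 w" "ell1_norm w B \<le> \<kappa> * ell1_norm w g"
    unfolding B_def using matrix_op_ell1(1) matrix_op_norm_le column_bounded_gain[OF t] g by auto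
  define q where "q n = f n + complex_of_real h * g n" for n
  have q: "q \<in> ell1 w"
    unfolding q_def[abs_def] by (rule ell1_add(1)[OF f' ell1_scale(1)[OF g]])
  have "cmod (q n) = cmod (f n) + h * cmod (g n)" if "1 \<le> n" for n
  proof -
    have "q n = complex_of_real (1 + h * a n t) * f n" by (simp add: q_def g_def algebra_simps)
    then have "cmod (q n) = \<bar>1 + h * a n t\<bar> * cmod (f n)"
      by (simp only: norm_mult norm_of_real)
    then show ?thesis
      using a_nonneg[OF that t] h by (simp add: g_def norm_mult algebra_simps)
  qed
  then have "ell1_norm w q = (\<Sum>\<^sub>\<infinity>n\<in>{1..}. w n * cmod (f n) + h * (w n * cmod (g n)))"
    unfolding ell1_norm_def by (intro infsum_cong) (simp add: algebra_simps)
  also have "\<dots> = ell1_norm w f + h * ell1_norm w g"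
    unfolding ell1_norm_def infsum_cmult_right'[symmetric]
    by (intro infsum_add summable_on_cmult_right summable_ell1 f' g)
  finally have nq: "ell1_norm w q = ell1_norm w f + h * ell1_norm w g" .
  have eq: "(\<lambda>n. f n - complex_of_real h * G_op a b t f n) = (\<lambda>n. q n - complex_of_real h * B n)"
    by (simp add: G_op_def A_op_def B_op_eq_matrix_op B_def q_def g_def[abs_def] algebra_simps)
  have "ell1_norm w q \<le> ell1_norm w (\<lambda>n. complex_of_real h * B n)
      + ell1_norm w (\<lambda>n. q n - complex_of_real h * B n)"
    by (rule ell1_norm_triangle_sub[OF q ell1_scale(1)[OF B(1)]])
  moreover have "ell1_norm w (\<lambda>n. complex_of_real h * B n) \<le> h * ell1_norm w g"
  proof -
    have "ell1_norm w B \<le> 1 * ell1_norm w g"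
      using B(2) mult_right_mono[of \<kappa> 1 "ell1_norm w g"] kappa ell1_norm_nonneg[of g] by linarith
    then show ?thesis using ell1_scale(2)[OF B(1)] h by (simp add: mult_left_mono)
  qed
  ultimately show ?thesis unfolding eq nq by linarith
qed

section \<open>Existence and uniqueness of classical solutions\<close>

lemma eventually_mem_within: "\<forall>\<^sub>F x in at t within S. x \<in> S \<and> x \<noteq> t"
  by (simp add: eventually_at_filter)

lemma eventually_after:
  fixes c t :: real
  assumes "c < t"
  shows "\<forall>\<^sub>F x in at t within S. c < x"
  using order_tendstoD(1)[OF tendsto_ident_at assms] .

lemma matrix_op_V_continuous:
  assumes "0 \<le> s" "f \<in> ell1 w"
  shows "continuous_map (top_of_set {s..T}) (ell1_top w) (\<lambda>t. matrix_op (V t s) f)"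
  unfolding continuous_map_ell1_iff
proof
  fix t assume t: "t \<in> {s..T}"
  show "limitin (ell1_top w) (\<lambda>t. matrix_op (V t s) f) (matrix_op (V t s) f) (at t within {s..T})"
  proof (rule limitin_matrix_op[OF assms(2)])
    show "\<forall>\<^sub>F x in at t within {s..T}. column_bounded (V x s) 1"
      using eventually_mem_within by eventually_elim (use column_bounded_V assms in blast)
    show "column_bounded (V t s) 1" by (rule column_bounded_V[OF assms(1) t])
    show "((\<lambda>x. V x s n j) \<longlongrightarrow> V t s n j) (at t within {s..T})" for n j
      using V_continuous[OF assms(1)] t by (auto simp: continuous_on_def)
  qed
qed

lemma classical_solution_matrix_op_V:
  assumes s: "0 \<le> s" and f: "f \<in> ell1 w"
  shows "classical_solution w T (A_dom w a) (G_op a b) s f (\<lambda>t. matrix_op (V t s) f)"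
  unfolding classical_solution_def
proof (intro conjI exI[of _ "\<lambda>t. matrix_op (VG t s) f"] ballI)
  show "continuous_map (top_of_set {s..T}) (ell1_top w) (\<lambda>t. matrix_op (V t s) f)"
    by (rule matrix_op_V_continuous[OF s f])
  show "matrix_op (V s s) f = f"
  proof -
    have "V s s = (\<lambda>n j. if n = j \<and> 1 \<le> n then 1 else 0)"
      by (intro ext V_init s)
    moreover have "f 0 = 0" using f by (simp add: ell1_def)
    ultimately show ?thesis by (simp only: matrix_op_ident)
  qed
  show "continuous_map (top_of_set {s<..T}) (ell1_top w) (\<lambda>t. matrix_op (VG t s) f)"
    unfolding continuous_map_ell1_iff
  proof
    fix t assume t: "t \<in> {s<..T}"
    \<comment> \<open>The bound on the columns of \<open>VG\<close> blows up at \<open>s\<close>. A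
      limit at \<open>t\<close> concerns only nearby times, and for those after \<open>c\<close> one
      bound serves.\<close>
    define c where "c = (s + t) / 2"
    have c: "s < c" "c < t" using t by (auto simp: c_def)
    have bd: "column_bounded (VG x s) (2 * load_const / (c - s))" if "c < x" "x \<le> T" for x
    proof -
      have "2 * load_const / (x - s) \<le> 2 * load_const / (c - s)"
        using that c load_const_nonneg by (intro divide_left_mono mult_pos_pos) auto
      then show ?thesis
        using column_bounded_mono[OF column_bounded_VG[OF s, of x]] that c by auto
    qed
    show "limitin (ell1_top w) (\<lambda>t. matrix_op (VG t s) f) (matrix_op (VG t s) f) (at t within {s<..T})"
    proof (rule limitin_matrix_op[OF f])
      show "\<forall>\<^sub>F x in at t within {s<..T}. column_bounded (VG x s) (2 * load_const / (c - s))"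
        using eventually_mem_within eventually_after[OF c(2)]
        by eventually_elim (use bd in auto)
      show "column_bounded (VG t s) (2 * load_const / (c - s))" using bd c t by auto
      show "((\<lambda>x. VG x s n j) \<longlongrightarrow> VG t s n j) (at t within {s<..T})" for n j
      proof -
        have "continuous_on {s<..T} (\<lambda>t. VG t s n j)"
          by (rule continuous_on_subset[OF VG_continuous[OF s]]) auto
        then show ?thesis using t by (simp add: continuous_on_def)
      qed
    qed
  qed
next
  fix t assume t: "t \<in> {s<..T}"
  define c where "c = (s + t) / 2"
  have c: "s < c" "c < t" using t by (auto simp: c_def)
  show "matrix_op (V t s) f \<in> A_dom w a t" "matrix_op (VG t s) f = G_op a b t (matrix_op (V t s) f)"
    using G_op_matrix_op_V[OF s _ _ f, of t] t by auto
  show "ell1_has_deriv w (\<lambda>t. matrix_op (V t s) f) (matrix_op (VG t s) f) t {s<..T}"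
    unfolding ell1_has_deriv_def
  proof (rule limitin_transform_eventually)
    show "\<forall>\<^sub>F r in at t within {s<..T}. matrix_op (\<lambda>n j. (V r s n j - V t s n j) / (r - t)) f
        = (\<lambda>n. (matrix_op (V r s) f n - matrix_op (V t s) f n) / complex_of_real (r - t))"
      using eventually_mem_within
    proof eventually_elim
      case (elim r)
      then show ?case
        using t s by (intro matrix_op_diff_quotient[OF column_bounded_V column_bounded_V f]) auto
    qed
    have "2 * load_const / (t - s) \<le> 2 * load_const / (c - s)"
      using c load_const_nonneg by (intro divide_left_mono mult_pos_pos) auto
    then have cVG: "column_bounded (VG t s) (2 * load_const / (c - s))"
      using column_bounded_mono[OF column_bounded_VG[OF s, of t]] t by auto
    show "limitin (ell1_top w) (\<lambda>r. matrix_op (\<lambda>n j. (V r s n j - V t s n j) / (r - t)) f) (matrix_op (VG t s) f)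
        (at t within {s<..T})"
    proof (rule limitin_matrix_op[OF f _ cVG])
      show "\<forall>\<^sub>F r in at t within {s<..T}.
          column_bounded (\<lambda>n j. (V r s n j - V t s n j) / (r - t)) (2 * load_const / (c - s))"
        using eventually_mem_within eventually_after[OF c(2)]
        by eventually_elim (rule column_bounded_V_quotient, use s c t in auto)
      fix n j
      have "((\<lambda>t. V t s n j) has_real_derivative VG t s n j) (at t within {s<..T})"
        by (rule DERIV_subset[OF V_deriv[OF s]]) (use t in auto)
      then show "((\<lambda>r. (V r s n j - V t s n j) / (r - t)) \<longlongrightarrow> VG t s n j) (at t within {s<..T})"
        by (simp add: has_field_derivative_iff)
    qed
  qed
qed

lemma ell1_norm_diff_le:
  assumes "f \<in> ell1 w" "g \<in> ell1 w"
  shows "ell1_norm w (\<lambda>n. f n - g n) \<le> ell1_norm w f + ell1_norm w g"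
  using ell1_norm_diff_triangle[OF assms(1) ell1_zero(1) assms(2)] ell1_norm_minus_commute[of "\<lambda>_. 0" g]
  by simp

lemma continuous_map_ell1_memD:
  "continuous_map (top_of_set S) (ell1_top w) u \<Longrightarrow> t \<in> S \<Longrightarrow> u t \<in> ell1 w"
  by (auto simp: continuous_map_ell1_iff limitin_ell1_iff)

lemma classical_solutionD:
  assumes "classical_solution w T D G s u0 u"
  shows "continuous_map (top_of_set {s..T}) (ell1_top w) u" "u s = u0"
    and "t \<in> {s<..T} \<Longrightarrow> u t \<in> D t"
    and "t \<in> {s<..T} \<Longrightarrow> ell1_has_deriv w u (G t (u t)) t {s<..T}"
  using assms unfolding classical_solution_def by auto

text \<open>An implicit Euler step: for \<open>r' = r - h\<close> the value at \<open>r\<close>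
  minus \<open>h\<close> times its image under the generator is the value at \<open>r'\<close> up to
  \<open>o(h)\<close>. Dissipativity at the later time \<open>r\<close>, applied to the difference
  of the solutions, then gives \<open>g r \<le> g r' + \<epsilon> * h\<close>.\<close>

lemma classical_solution_unique:
  assumes s: "0 \<le> s"
    and u: "classical_solution w T (A_dom w a) (G_op a b) s u0 u"
    and v: "classical_solution w T (A_dom w a) (G_op a b) s u0 v"
    and t: "t \<in> {s..T}"
  shows "u t = v t"
proof -
  define g where "g r = ell1_norm w (\<lambda>n. u r n - v r n)" for r
  have mem: "u r \<in> ell1 w" "v r \<in> ell1 w" if "r \<in> {s..T}" for r
  proof -
    have "continuous_map (top_of_set {s..T}) (ell1_top w) u" "continuous_map (top_of_set {s..T}) (ell1_top w) v"
      using u v by (simp_all add: classical_solution_def)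
    then show "u r \<in> ell1 w" "v r \<in> ell1 w" using continuous_map_ell1_memD that by blast+
  qed
  have lim: "((\<lambda>r. ell1_norm w (\<lambda>n. u r n - u x n)) \<longlongrightarrow> 0) (at x within {s..T})"
    "((\<lambda>r. ell1_norm w (\<lambda>n. v r n - v x n)) \<longlongrightarrow> 0) (at x within {s..T})" if "x \<in> {s..T}" for x
    using u v that by (auto simp: classical_solution_def continuous_map_ell1_iff limitin_ell1_iff)
  have "continuous_on {s..T} g"
    unfolding continuous_on_def
  proof
    fix x assume x: "x \<in> {s..T}"
    have "\<forall>\<^sub>F r in at x within {s..T}.
        norm (g r - g x) \<le> ell1_norm w (\<lambda>n. u r n - u x n) + ell1_norm w (\<lambda>n. v r n - v x n)"
      using eventually_mem_within
    proof eventually_elim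
      case (elim r)
      note m = mem[OF x] mem[of r]
      define p where "p n = u r n - v r n" for n
      define q where "q n = u x n - v x n" for n
      have pq: "p \<in> ell1 w" "q \<in> ell1 w"
        unfolding p_def[abs_def] q_def[abs_def] using m elim by (auto intro: ell1_diff')
      have "(\<lambda>n. p n - q n) = (\<lambda>n. (u r n - u x n) - (v r n - v x n))"
        by (simp add: p_def q_def algebra_simps)
      then have "ell1_norm w (\<lambda>n. p n - q n)
          \<le> ell1_norm w (\<lambda>n. u r n - u x n) + ell1_norm w (\<lambda>n. v r n - v x n)"
        using ell1_norm_diff_le[OF ell1_diff' ell1_diff', of "u r" "u x" "v r" "v x"] m elim by simp
      moreover have "g r = ell1_norm w p" "g x = ell1_norm w q"
        by (simp_all add: g_def p_def[abs_def] q_def[abs_def])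
      ultimately show ?case
        using ell1_norm_triangle_sub[OF pq] ell1_norm_triangle_sub[OF pq(2,1)]
          ell1_norm_minus_commute[of p q] by (simp add: abs_le_iff)
    qed
    then have "((\<lambda>r. g r - g x) \<longlongrightarrow> 0) (at x within {s..T})"
      by (rule Lim_null_comparison) (use tendsto_add[OF lim[OF x]] in simp)
    then show "(g \<longlongrightarrow> g x) (at x within {s..T})" by (simp add: LIM_zero_iff)
  qed
  then have cont: "continuous_on {s..t} g" by (rule continuous_on_subset) (use t in auto)
  have "g t \<le> g s"
  proof (rule nonincreasing_if_left_Dini_nonpos[OF cont])
    show "s \<le> t" using t by simp
    fix r \<epsilon> :: real assume r: "s < r" "r \<le> t" and \<epsilon>: "0 < \<epsilon>"
    then have rT: "r \<in> {s<..T}" "r \<in> {0..T}" "r \<in> {s..T}" using t s by auto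
    define Gu where "Gu = G_op a b r (u r)"
    define Gv where "Gv = G_op a b r (v r)"
    define qu where "qu r' n = (u r' n - u r n) / complex_of_real (r' - r)" for r' n
    define qv where "qv r' n = (v r' n - v r n) / complex_of_real (r' - r)" for r' n
    have D: "u r \<in> A_dom w a r" "v r \<in> A_dom w a r"
      and qlim: "limitin (ell1_top w) qu Gu (at r within {s<..T})"
        "limitin (ell1_top w) qv Gv (at r within {s<..T})"
      using classical_solutionD(3,4)[OF u rT(1)] classical_solutionD(3,4)[OF v rT(1)]
      by (simp_all add: ell1_has_deriv_def Gu_def Gv_def qu_def[abs_def] qv_def[abs_def])
    have "\<forall>\<^sub>F r' in at r within {s<..T}. (qu r' \<in> ell1 w \<and> ell1_norm w (\<lambda>n. qu r' n - Gu n) < \<epsilon> / 2)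
        \<and> (qv r' \<in> ell1 w \<and> ell1_norm w (\<lambda>n. qv r' n - Gv n) < \<epsilon> / 2)"
      using qlim order_tendstoD(2)[OF _ half_gt_zero[OF \<epsilon>]]
      unfolding limitin_ell1_iff eventually_conj_iff by blast
    then obtain \<delta> where \<delta>: "\<delta> > 0" and near: "\<And>r'. r' \<in> {s<..T} \<Longrightarrow> r' \<noteq> r \<Longrightarrow> dist r' r < \<delta> \<Longrightarrow>
        (qu r' \<in> ell1 w \<and> ell1_norm w (\<lambda>n. qu r' n - Gu n) < \<epsilon> / 2)
        \<and> (qv r' \<in> ell1 w \<and> ell1_norm w (\<lambda>n. qv r' n - Gv n) < \<epsilon> / 2)"
      unfolding eventually_at by blast
    have "g r - g r' \<le> \<epsilon> * (r - r')" if r': "s < r'" "r - \<delta> < r'" "r' < r" for r'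
    proof -
      note n = near[of r', unfolded dist_real_def]
      have q: "qu r' \<in> ell1 w" "ell1_norm w (\<lambda>n. qu r' n - Gu n) < \<epsilon> / 2"
        "qv r' \<in> ell1 w" "ell1_norm w (\<lambda>n. qv r' n - Gv n) < \<epsilon> / 2"
        using n r' rT by auto
      define h where "h = r - r'"
      have h: "h > 0" using r' by (simp add: h_def)
      note GuGv = G_op_ell1[OF rT(2) D(1), folded Gu_def] G_op_ell1[OF rT(2) D(2), folded Gv_def]
      \<comment> \<open>The joint error of the two difference quotients. With
        \<open>z = u - v\<close>, the Euler step reads
        \<open>z r - h * G (z r) = z r' + h * e\<close>.\<close>
      define e where "e n = (qu r' n - Gu n) - (qv r' n - Gv n)" for n
      have e: "e \<in> ell1 w" "ell1_norm w e \<le> \<epsilon>"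
        using ell1_norm_diff_le[OF ell1_diff'[OF _ q(1) GuGv(1)] ell1_diff'[OF _ q(3) GuGv(2)]] q
          ell1_diff'[OF _ ell1_diff'[OF _ q(1) GuGv(1)] ell1_diff'[OF _ q(3) GuGv(2)]]
        by (auto simp: e_def[abs_def])
      have z': "(\<lambda>n. u r' n - v r' n) \<in> ell1 w"
        using mem[of r'] r' rT by (intro ell1_diff') auto
      have "g r \<le> ell1_norm w (\<lambda>n. (u r n - v r n) - complex_of_real h * (Gu n - Gv n))"
        using G_op_dissipative[OF rT(2) G_op_diff(1)[OF rT(2) D], of h] h
        unfolding G_op_diff(2)[OF rT(2) D] Gu_def[symmetric] Gv_def[symmetric] by (simp add: g_def)
      also have "(\<lambda>n. (u r n - v r n) - complex_of_real h * (Gu n - Gv n))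
          = (\<lambda>n. (u r' n - v r' n) - complex_of_real (- h) * e n)"
      proof
        fix n
        have "complex_of_real (- h) * qu r' n = u r' n - u r n"
          "complex_of_real (- h) * qv r' n = v r' n - v r n"
          using h unfolding qu_def qv_def h_def by simp_all
        then show "(u r n - v r n) - complex_of_real h * (Gu n - Gv n)
            = (u r' n - v r' n) - complex_of_real (- h) * e n"
          by (simp add: e_def algebra_simps)
      qed
      also have "ell1_norm w \<dots> \<le> g r' + ell1_norm w (\<lambda>n. complex_of_real (- h) * e n)"
        unfolding g_def by (rule ell1_norm_diff_le[OF z' ell1_scale(1)[OF e(1)]])
      also have "ell1_norm w (\<lambda>n. complex_of_real (- h) * e n) \<le> h * \<epsilon>"
        using e h unfolding ell1_scale(2)[OF e(1)] norm_of_real by simp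
      finally show ?thesis by (simp add: h_def mult.commute)
    qed
    then show "\<exists>\<delta>>0. \<forall>r'. s < r' \<and> r - \<delta> < r' \<and> r' < r \<longrightarrow> g r - g r' \<le> \<epsilon> * (r - r')"
      using \<delta> by blast
  qed
  moreover have "u s = u0" "v s = u0" using u v by (auto simp: classical_solution_def)
  ultimately have "g t \<le> 0" using ell1_zero(2) by (simp add: g_def)
  then have "ell1_dist w (u t) (v t) = 0"
    using ell1_norm_nonneg[of "\<lambda>n. u t n - v t n"] by (simp add: g_def ell1_dist_def)
  then show ?thesis
    using Metric_space.zero[OF Metric_space_ell1[of w, OF w_pos] mem[OF t]] by simp
qed

section \<open>The evolution family\<close>

text \<open>Uniqueness: a solution started at \<open>s\<close> is, from \<open>r\<close> on, a
  classical solution with initial value its own value at \<open>r\<close>.\<close>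

lemma matrix_op_V_evolution:
  assumes "0 \<le> s" "s \<le> r" "r \<le> t" "t \<le> T" and f: "f \<in> ell1 w"
  shows "matrix_op (V t r) (matrix_op (V r s) f) = matrix_op (V t s) f"
proof -
  have fr: "matrix_op (V r s) f \<in> ell1 w"
    using matrix_op_ell1(1)[OF column_bounded_V f] assms by auto
  note sol = classical_solution_matrix_op_V[OF assms(1) f]
  have sub: "{r..T} \<subseteq> {s..T}" "{r<..T} \<subseteq> {s<..T}" using assms by auto
  have "classical_solution w T (A_dom w a) (G_op a b) r (matrix_op (V r s) f) (\<lambda>t. matrix_op (V t s) f)"
    unfolding classical_solution_def
  proof (intro conjI exI[of _ "\<lambda>t. G_op a b t (matrix_op (V t s) f)"] ballI refl)
    show "continuous_map (top_of_set {r..T}) (ell1_top w) (\<lambda>t. matrix_op (V t s) f)"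
      using classical_solutionD(1)[OF sol] sub(1) by (rule continuous_map_from_subtopology_mono)
    obtain u' where u': "continuous_map (top_of_set {s<..T}) (ell1_top w) u'"
      "\<forall>t\<in>{s<..T}. u' t = G_op a b t (matrix_op (V t s) f)"
      using sol unfolding classical_solution_def by blast
    have "continuous_map (top_of_set {r<..T}) (ell1_top w) u'"
      using u'(1) sub(2) by (rule continuous_map_from_subtopology_mono)
    then show "continuous_map (top_of_set {r<..T}) (ell1_top w) (\<lambda>t. G_op a b t (matrix_op (V t s) f))"
      by (rule continuous_map_eq) (use u'(2) sub(2) in auto)
    fix t assume "t \<in> {r<..T}"
    then have t: "t \<in> {s<..T}" using sub by auto
    show "matrix_op (V t s) f \<in> A_dom w a t" by (rule classical_solutionD(3)[OF sol t])
    show "ell1_has_deriv w (\<lambda>t. matrix_op (V t s) f) (G_op a b t (matrix_op (V t s) f)) t {r<..T}"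
      using classical_solutionD(4)[OF sol t] filter_leD[OF at_le[OF sub(2)]]
      unfolding ell1_has_deriv_def limitin_def by blast
  qed
  from classical_solution_unique[OF _ classical_solution_matrix_op_V[OF _ fr] this, of t] assms
  show ?thesis by auto
qed

lemma V_evolution:
  assumes "0 \<le> s" "s \<le> r" "r \<le> t" "t \<le> T" and j: "1 \<le> j"
  shows "V t s n j = (\<Sum>k=1..j. V t r n k * V r s k j)"
proof -
  let ?e = "\<lambda>i. if i = j then 1 else 0"
  have "matrix_op (\<lambda>n j. \<Sum>k=1..j. V t r n k * V r s k j) ?e = matrix_op (V t s) ?e"
    using matrix_op_V_evolution[OF assms(1-4) unit_in_ell1[OF j]] assms
    by (subst matrix_op_compose[symmetric, OF column_bounded_V column_bounded_V unit_in_ell1[OF j]]) auto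
  from fun_cong[OF this, of n] show ?thesis
    unfolding matrix_op_unit[OF j] of_real_eq_iff by (rule sym)
qed

section \<open>Joint continuity in both times\<close>

lemma load_le_uniform:
  assumes j: "1 \<le> j"
  obtains L where "L \<ge> 0" "\<And>s t. 0 \<le> s \<Longrightarrow> s \<le> t \<Longrightarrow> t \<le> T \<Longrightarrow> load t s j \<le> L"
proof -
  \<comment> \<open>A common bound for the rates of indices up to \<open>j\<close>, from Hoelder
    continuity at time 0. Unlike the smoothing estimate it has no singularity at
    \<open>t = s\<close>, at the price of depending on \<open>j\<close>. This suffices for the
    continuity of single entries; the domination over columns comes from
    \<open>column_bounded_V\<close>.\<close>
  define A where "A = (\<Sum>k=1..j. a k 0 + C1 * (1 + a k 0) * T powr \<sigma>)"
  have T0: "0 \<in> {0..T}" using T by simp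
  have pos: "0 \<le> a k 0 + C1 * (1 + a k 0) * T powr \<sigma>" if "1 \<le> k" for k
    using a_nonneg[OF that T0] constants by simp
  have a_le: "a k t \<le> A" if k: "k \<in> {1..j}" and t: "t \<in> {0..T}" for k t
  proof -
    have "a k t \<le> a k 0 + C1 * (1 + a k 0) * \<bar>t - 0\<bar> powr \<sigma>"
      using a_holder[of k 0 t] k t T0 by auto
    also have "\<dots> \<le> a k 0 + C1 * (1 + a k 0) * T powr \<sigma>"
      using t constants a_nonneg[of k 0] k T0 by (intro add_left_mono mult_left_mono powr_mono2) auto
    also have "\<dots> \<le> A"
      unfolding A_def
      by (rule member_le_sum[where f = "\<lambda>k. a k 0 + C1 * (1 + a k 0) * T powr \<sigma>"]) (use k pos in auto)
    finally show ?thesis .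
  qed
  have A: "0 \<le> A" unfolding A_def by (rule sum_nonneg) (use pos in auto)
  show ?thesis
  proof (rule that[of "A * w j"])
    show "0 \<le> A * w j" using A w_pos[OF j] by simp
    fix s t assume st: "0 \<le> s" "s \<le> t" "t \<le> T"
    have "load t s j \<le> (\<Sum>k=1..j. A * (w k * V t s k j))"
      unfolding load_def
    proof (rule sum_mono)
      fix k assume k: "k \<in> {1..j}"
      have "a k t * (w k * V t s k j) \<le> A * (w k * V t s k j)"
        using a_le[OF k, of t] st V_nonneg[OF st(1), of t k j] w_pos[of k] k
        by (intro mult_right_mono) auto
      then show "w k * a k t * V t s k j \<le> A * (w k * V t s k j)" by (simp add: mult_ac)
    qed
    also have "\<dots> \<le> A * w j"
      unfolding sum_distrib_left[symmetric] using V_mass[OF st(1) _ j] st A by (intro mult_left_mono) auto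
    finally show "load t s j \<le> A * w j" .
  qed
qed

text \<open>By \<open>V_evolution\<close>, moving the initial time is controlled by moving the final time.\<close>

lemma V_Lipschitz:
  assumes n: "1 \<le> n" and j: "1 \<le> j"
  obtains L where "\<And>s t s' t'. 0 \<le> s \<Longrightarrow> s \<le> t \<Longrightarrow> t \<le> T \<Longrightarrow> 0 \<le> s' \<Longrightarrow> s' \<le> t' \<Longrightarrow> t' \<le> T \<Longrightarrow>
    \<bar>V t s n j - V t' s' n j\<bar> \<le> L * (\<bar>t - t'\<bar> + \<bar>s - s'\<bar>)"
proof -
  obtain L where L: "L \<ge> 0" "\<And>s t. 0 \<le> s \<Longrightarrow> s \<le> t \<Longrightarrow> t \<le> T \<Longrightarrow> load t s j \<le> L"
    using load_le_uniform[OF j] by blast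
  have wn: "0 < w n" by (rule w_pos[OF n])
  have sum_diff: "(\<Sum>k=1..j. w k * \<bar>V t s k j - V t' s k j\<bar>) \<le> 2 * L * \<bar>t - t'\<bar>"
    if "0 \<le> s" "s \<le> t" "t \<le> T" "s \<le> t'" "t' \<le> T" for s t t'
    by (rule V_increment[of s s T]) (use that L in auto)
  have time: "w n * \<bar>V t s n j - V t' s n j\<bar> \<le> 2 * L * \<bar>t - t'\<bar>"
    if "0 \<le> s" "s \<le> t" "t \<le> T" "s \<le> t'" "t' \<le> T" for s t t'
  proof (cases "n \<le> j")
    case True
    then have "w n * \<bar>V t s n j - V t' s n j\<bar> \<le> (\<Sum>k=1..j. w k * \<bar>V t s k j - V t' s k j\<bar>)"
      using n w_pos by (intro member_le_sum[where f = "\<lambda>k. w k * \<bar>V t s k j - V t' s k j\<bar>"])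
        (auto simp: less_imp_le)
    then show ?thesis using sum_diff[OF that] by linarith
  qed (use L in auto)
  have start: "w n * \<bar>V t s n j - V t s' n j\<bar> \<le> 2 * L * (s' - s)"
    if st: "0 \<le> s" "s \<le> s'" "s' \<le> t" "t \<le> T" for s s' t
  proof -
    \<comment> \<open>The unit column is written as a column of \<open>V s s\<close>, which gives
      both terms the common left factor \<open>V t s'\<close>; its entries in row \<open>n\<close>
      are at most \<open>w k / w n\<close>.\<close>
    have "V t s' n j = (\<Sum>k=1..j. V t s' n k * V s s k j)"
    proof -
      have "(\<Sum>k=1..j. V t s' n k * V s s k j) = (\<Sum>k=1..j. if k = j then V t s' n k else 0)"
        using st by (intro sum.cong) (auto simp: V_init)
      then show ?thesis using j by simp
    qed
    then have "V t s n j - V t s' n j = (\<Sum>k=1..j. V t s' n k * (V s' s k j - V s s k j))"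
      using V_evolution[OF st j, of n] by (simp add: right_diff_distrib sum_subtractf)
    then have "w n * \<bar>V t s n j - V t s' n j\<bar> \<le> w n * (\<Sum>k=1..j. \<bar>V t s' n k * (V s' s k j - V s s k j)\<bar>)"
      using wn by (intro mult_left_mono) (simp_all only: sum_abs less_imp_le)
    also have "\<dots> = (\<Sum>k=1..j. (w n * \<bar>V t s' n k\<bar>) * \<bar>V s' s k j - V s s k j\<bar>)"
      by (simp add: sum_distrib_left abs_mult mult_ac)
    also have "\<dots> \<le> (\<Sum>k=1..j. w k * \<bar>V s' s k j - V s s k j\<bar>)"
      using column_bounded_entry[OF column_bounded_V, of s' t n] n st
      by (intro sum_mono mult_right_mono) auto
    also have "\<dots> \<le> 2 * L * (s' - s)" using sum_diff[of s s' s] st by auto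
    finally show ?thesis .
  qed
  \<comment> \<open>For \<open>t \<le> t'\<close> the corner \<open>(t', s)\<close> is an admissible
    pair of times, whereas \<open>(t, s')\<close> need not be, since \<open>s'\<close> may exceed
    \<open>t\<close>.\<close>
  have ordered: "w n * \<bar>V t s n j - V t' s' n j\<bar> \<le> 2 * L * (\<bar>t - t'\<bar> + \<bar>s - s'\<bar>)"
    if st: "0 \<le> s" "s \<le> t" "0 \<le> s'" "s' \<le> t'" "t \<le> t'" "t' \<le> T" for s t s' t'
  proof -
    have "w n * \<bar>V t' s n j - V t' s' n j\<bar> \<le> 2 * L * \<bar>s - s'\<bar>"
      using start[of s s' t'] start[of s' s t'] st by (cases "s \<le> s'") (auto simp: abs_minus_commute)
    moreover have "w n * \<bar>V t s n j - V t' s n j\<bar> \<le> 2 * L * \<bar>t - t'\<bar>"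
      using st by (intro time) auto
    moreover have "w n * \<bar>V t s n j - V t' s' n j\<bar>
        \<le> w n * (\<bar>V t s n j - V t' s n j\<bar> + \<bar>V t' s n j - V t' s' n j\<bar>)"
      using wn by (intro mult_left_mono) auto
    ultimately show ?thesis by (simp add: distrib_left)
  qed
  have "w n * \<bar>V t s n j - V t' s' n j\<bar> \<le> 2 * L * (\<bar>t - t'\<bar> + \<bar>s - s'\<bar>)"
    if "0 \<le> s" "s \<le> t" "t \<le> T" "0 \<le> s'" "s' \<le> t'" "t' \<le> T" for s t s' t'
    using ordered[of s t s' t'] ordered[of s' t' s t] that
    by (cases "t \<le> t'") (auto simp: abs_minus_commute)
  then show ?thesis
    using wn by (intro that[of "2 * L / w n"]) (simp add: field_simps)
qed

lemma evolution_family_matrix_op_V: "evolution_family w T (\<lambda>t s. matrix_op (V t s))"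
  unfolding evolution_family_def
proof (intro conjI allI impI ballI)
  fix s t assume st: "0 \<le> s \<and> s \<le> t \<and> t \<le> T"
  then have cb: "column_bounded (V t s) 1" by (intro column_bounded_V) auto
  show "ell1_bounded_linear w (matrix_op (V t s))"
    unfolding ell1_bounded_linear_def
    using matrix_op_ell1(1)[OF cb] matrix_op_add[OF cb] matrix_op_cmult matrix_op_norm_le[OF cb] by blast
next
  fix s f assume "0 \<le> s \<and> s \<le> T" "f \<in> ell1 w"
  then show "matrix_op (V s s) f = f"
    using classical_solutionD(2)[OF classical_solution_matrix_op_V] by blast
next
  fix s r t f assume "0 \<le> s \<and> s \<le> r \<and> r \<le> t \<and> t \<le> T" "f \<in> ell1 w"
  then show "matrix_op (V t r) (matrix_op (V r s) f) = matrix_op (V t s) f" by (intro matrix_op_V_evolution) auto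
next
  fix f assume f: "f \<in> ell1 w"
  define S where "S = {(t, s). 0 \<le> s \<and> s \<le> t \<and> t \<le> T}"
  show "continuous_map (top_of_set {(t, s). 0 \<le> s \<and> s \<le> t \<and> t \<le> T}) (ell1_top w) (\<lambda>(t, s). matrix_op (V t s) f)"
    unfolding S_def[symmetric] continuous_map_ell1_iff case_prod_beta
  proof
    fix x :: "real \<times> real" assume x: "x \<in> S"
    show "limitin (ell1_top w) (\<lambda>y. matrix_op (V (fst y) (snd y)) f) (matrix_op (V (fst x) (snd x)) f) (at x within S)"
    proof (rule limitin_matrix_op[OF f])
      show "\<forall>\<^sub>F y in at x within S. column_bounded (V (fst y) (snd y)) 1"
        using eventually_mem_within by eventually_elim (use column_bounded_V in \<open>auto simp: S_def\<close>)
      show "column_bounded (V (fst x) (snd x)) 1" using x by (intro column_bounded_V) (auto simp: S_def)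
      fix n j :: nat assume n: "1 \<le> n" "n \<le> j"
      then have j: "1 \<le> j" by simp
      obtain L where L: "\<And>s t s' t'. 0 \<le> s \<Longrightarrow> s \<le> t \<Longrightarrow> t \<le> T \<Longrightarrow> 0 \<le> s' \<Longrightarrow> s' \<le> t' \<Longrightarrow> t' \<le> T \<Longrightarrow>
          \<bar>V t s n j - V t' s' n j\<bar> \<le> L * (\<bar>t - t'\<bar> + \<bar>s - s'\<bar>)"
        using V_Lipschitz[OF n(1) j] by blast
      have "((\<lambda>y. L * (\<bar>fst y - fst x\<bar> + \<bar>snd y - snd x\<bar>)) \<longlongrightarrow>
          L * (\<bar>fst x - fst x\<bar> + \<bar>snd x - snd x\<bar>)) (at x within S)"
        by (intro tendsto_intros)
      then have lim: "((\<lambda>y. L * (\<bar>fst y - fst x\<bar> + \<bar>snd y - snd x\<bar>)) \<longlongrightarrow> 0) (at x within S)" by simp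
      have "\<forall>\<^sub>F y in at x within S. norm (V (fst y) (snd y) n j - V (fst x) (snd x) n j)
          \<le> L * (\<bar>fst y - fst x\<bar> + \<bar>snd y - snd x\<bar>)"
        using eventually_mem_within
        by eventually_elim (use x in \<open>auto simp: S_def intro!: L\<close>)
      then have "((\<lambda>y. V (fst y) (snd y) n j - V (fst x) (snd x) n j) \<longlongrightarrow> 0) (at x within S)"
        using lim by (rule Lim_null_comparison)
      then show "((\<lambda>y. V (fst y) (snd y) n j) \<longlongrightarrow> V (fst x) (snd x) n j) (at x within S)"
        by (simp add: LIM_zero_iff)
    qed
  qed
qed

section \<open>Strict positivity and conservation of the first moment\<close>

lemma V_diagonal_pos:
  assumes s: "0 \<le> s" and t: "t \<in> {s..T}" and j: "1 \<le> j"
  shows "0 < V t s j j"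
proof -
  have a: "continuous_on {s..T} (a j)"
    by (rule continuous_on_subset[OF continuous_a[OF j]]) (use s in auto)
  obtain A where A: "A s = 0"
    "\<And>t. t \<in> {s..T} \<Longrightarrow> (A has_real_derivative a j t) (at t within {s..T})"
    using exists_antiderivative[OF a] by blast
  \<comment> \<open>No entry feeds the diagonal one, which therefore decays exactly like
    \<open>exp (- A t)\<close>; this half of the equality gives positivity.\<close>
  have "0 \<le> V t s j j - exp (- A t)"
  proof (rule linear_differential_inequality_nonneg[OF _ a _ _ t, where y = "\<lambda>t. V t s j j - exp (- A t)"
        and y' = "\<lambda>r. VG r s j j - exp (- A r) * - a j r"])
    fix r assume r: "r \<in> {s..T}"
    have "((\<lambda>t. exp (- A t)) has_real_derivative exp (- A r) * - a j r) (at r within {s..T})"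
      by (rule derivative_eq_intros A(2) r refl)+
    from DERIV_diff[OF V_deriv[OF s r] this]
    show "((\<lambda>t. V t s j j - exp (- A t)) has_real_derivative VG r s j j - exp (- A r) * - a j r)
        (at r within {s..T})" .
    show "- a j r * (V r s j j - exp (- A r)) \<le> VG r s j j - exp (- A r) * - a j r"
      using j by (simp add: VG_def algebra_simps)
  next
    show "0 \<le> V s s j j - exp (- A s)" using s j by (simp add: V_init A)
  qed
  then show ?thesis using exp_gt_zero[of "- A t"] by linarith
qed

text \<open>The adjoint generator annihilates the row with entries \<open>n\<close>: for
  \<open>k = 1\<close> because the rate vanishes, for \<open>k \<ge> 2\<close> by the mass balance
  of the fragments.\<close>

lemma V_first_moment:
  assumes a1: "\<forall>t\<in>{0..T}. a 1 t = 0"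
    and b1: "\<forall>j\<ge>2. \<forall>t\<in>{0..T}. (\<Sum>n=1..j-1. real n * b n j t) = real j"
    and s: "0 \<le> s" and t: "t \<in> {s..T}" and j: "1 \<le> j"
  shows "(\<Sum>n=1..j. real n * V t s n j) = real j"
proof -
  have zero: "(\<Sum>n=1..j. real n * VG r s n j) = 0" if r: "r \<in> {s..T}" for r
    unfolding sum_VG
  proof (rule sum.neutral, rule ballI)
    fix k assume k: "k \<in> {1..j}"
    show "a k r * ((\<Sum>n=1..k-1. real n * b n k r) - real k) * V r s k j = 0"
    proof (cases "k = 1")
      case True
      then show ?thesis using a1 r s by simp
    next
      case False
      then have "2 \<le> k" "r \<in> {0..T}" using k r s by auto
      then have "(\<Sum>n=1..k-1. real n * b n k r) = real k" using b1 by blast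
      then show ?thesis by simp
    qed
  qed
  have "norm ((\<Sum>n=1..j. real n * V t s n j) - (\<Sum>n=1..j. real n * V s s n j)) \<le> 0 * norm (t - s)"
    by (rule field_differentiable_bound[OF convex_real_interval(5)[of s T] V_sum_deriv[OF s]])
      (use zero t in auto)
  moreover have "(\<Sum>n=1..j. real n * V s s n j) = (\<Sum>n=1..j. if n = j then real n else 0)"
    using s by (intro sum.cong) (auto simp: V_init)
  ultimately show ?thesis using j by simp
qed

end

theorem theorem3p5:
  fixes T \<kappa> C1 C2 \<sigma> :: real
    and a :: "nat \<Rightarrow> real \<Rightarrow> real"
    and b :: "nat \<Rightarrow> nat \<Rightarrow> real \<Rightarrow> real"
    and w :: "nat \<Rightarrow> real"
  assumes T: "T > 0"
    and w_pos: "\<And>n. n \<ge> 1 \<Longrightarrow> w n > 0"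
    and A1: "\<And>n t. n \<ge> 1 \<Longrightarrow> t \<in> {0..T} \<Longrightarrow> a n t \<ge> 0"
    and A2: "\<And>n j t. n \<ge> 1 \<Longrightarrow> j \<ge> 1 \<Longrightarrow> t \<in> {0..T} \<Longrightarrow>
               b n j t \<ge> 0 \<and> (j \<le> n \<longrightarrow> b n j t = 0)"
    and A3: "\<And>n. n \<ge> 1 \<Longrightarrow> w n \<ge> real n"
    and kappa: "0 < \<kappa>" "\<kappa> < 1"
    and A4: "\<And>j t. j \<ge> 2 \<Longrightarrow> t \<in> {0..T} \<Longrightarrow> (\<Sum>n=1..j-1. w n * b n j t) \<le> \<kappa> * w j"
    and constants: "C1 \<ge> 0" "C2 \<ge> 0" "0 < \<sigma>" "\<sigma> \<le> 1"
    and A5: "\<And>n s t \<tau>. n \<ge> 1 \<Longrightarrow> s \<in> {0..T} \<Longrightarrow> t \<in> {0..T} \<Longrightarrow> \<tau> \<in> {0..T} \<Longrightarrow>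
               \<bar>a n t - a n s\<bar> / (1 + a n \<tau>) \<le> C1 * \<bar>t - s\<bar> powr \<sigma>"
    and A6: "\<And>j s t \<tau>. j \<ge> 2 \<Longrightarrow> s \<in> {0..T} \<Longrightarrow> t \<in> {0..T} \<Longrightarrow> \<tau> \<in> {0..T} \<Longrightarrow>
               1 / (1 + a j \<tau>) * (\<Sum>n=1..j-1. w n * \<bar>a j t * b n j t - a j s * b n j s\<bar>)
                 \<le> C2 * w j * \<bar>t - s\<bar> powr \<sigma>"
  shows "\<exists>U. evolution_family w T U \<and>
    (\<forall>s\<in>{0..<T}. \<forall>u0\<in>ell1 w.
       classical_solution w T (A_dom w a) (G_op a b) s u0 (\<lambda>t. U t s u0) \<and>
       (\<forall>v. classical_solution w T (A_dom w a) (G_op a b) s u0 v \<longrightarrow>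
          (\<forall>t\<in>{s..T}. v t = U t s u0))) \<and>
    (\<forall>s\<in>{0..<T}. \<forall>u0\<in>ell1_cone w. \<forall>t\<in>{s..T}.
       U t s u0 \<in> ell1_cone w \<and> (u0 \<noteq> (\<lambda>n. 0) \<longrightarrow> U t s u0 \<noteq> (\<lambda>n. 0))) \<and>
    ((\<forall>t\<in>{0..T}. a 1 t = 0) \<and>
     (\<forall>j\<ge>2. \<forall>t\<in>{0..T}. (\<Sum>n=1..j-1. real n * b n j t) = real j) \<longrightarrow>
     (\<forall>s\<in>{0..<T}. \<forall>u0\<in>ell1_cone w. \<forall>t\<in>{s..T}.
        first_moment (U t s u0) = first_moment u0))"
proof -
  have w1: "0 < 1 + a n t" if "n \<ge> 1" "t \<in> {0..T}" for n t
    using A1[OF that] by simp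
  interpret fragmentation w T \<kappa> C1 C2 \<sigma> a b
  proof
    fix j :: nat and t assume j: "j \<ge> 1" and t: "t \<in> {0..T}"
    show "(\<Sum>n=1..j-1. w n * b n j t) \<le> \<kappa> * w j"
      using A4[of j t] w_pos[OF j] kappa j t by (cases "j = 1") auto
  next
    fix n :: nat and s t assume n: "n \<ge> 1" and st: "s \<in> {0..T}" "t \<in> {0..T}"
    show "\<bar>a n t - a n s\<bar> \<le> C1 * (1 + a n s) * \<bar>t - s\<bar> powr \<sigma>"
      using A5[OF n st st(1)] w1[OF n st(1)] by (simp add: pos_divide_le_eq mult_ac)
  next
    fix j :: nat and s t assume j: "j \<ge> 1" and st: "s \<in> {0..T}" "t \<in> {0..T}"
    show "(\<Sum>n=1..j-1. w n * \<bar>a j t * b n j t - a j s * b n j s\<bar>)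
        \<le> C2 * w j * (1 + a j s) * \<bar>t - s\<bar> powr \<sigma>"
    proof (cases "j = 1")
      case True
      then show ?thesis using constants w_pos[of 1] w1[of 1 s] st by simp
    next
      case False
      then show ?thesis
        using A6[of j s t s] j st w1[OF j st(1)] by (simp add: pos_divide_le_eq mult_ac)
    qed
  qed (use T w_pos A1 A2 kappa constants in auto)
  have in_ell1: "u0 \<in> ell1 w" if "u0 \<in> ell1_cone w" for u0
    using that by (simp add: ell1_cone_def)
  have cone: "matrix_op (V t s) u0 \<in> ell1_cone w" "u0 \<noteq> (\<lambda>n. 0) \<Longrightarrow> matrix_op (V t s) u0 \<noteq> (\<lambda>n. 0)"
    if s: "s \<in> {0..<T}" and u0: "u0 \<in> ell1_cone w" and t: "t \<in> {s..T}" for s t u0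
  proof -
    have st: "0 \<le> s" "t \<in> {s..T}" using s t by auto
    note c = matrix_op_cone[OF column_bounded_V[OF st] V_nonneg[OF st] u0]
    show "matrix_op (V t s) u0 \<in> ell1_cone w" by (rule c(1))
    assume "u0 \<noteq> (\<lambda>n. 0)"
    then obtain j where j: "u0 j \<noteq> 0" by auto
    \<comment> \<open>Index 0 is excluded by the convention \<open>u0 0 = 0\<close>. The entry
      \<open>j\<close> stays nonzero because the diagonal of \<open>V t s\<close> is
      positive.\<close>
    then have j1: "1 \<le> j" using in_ell1[OF u0] by (cases j) (auto simp: ell1_def)
    have "matrix_op (V t s) u0 j \<noteq> 0" using c(2)[OF _ j1, of j] V_diagonal_pos[OF st j1] j by auto
    then show "matrix_op (V t s) u0 \<noteq> (\<lambda>n. 0)" by auto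
  qed
  have moment: "first_moment (matrix_op (V t s) u0) = first_moment u0"
    if "\<forall>t\<in>{0..T}. a 1 t = 0" "\<forall>j\<ge>2. \<forall>t\<in>{0..T}. (\<Sum>n=1..j-1. real n * b n j t) = real j"
      and s: "s \<in> {0..<T}" and u0: "u0 \<in> ell1_cone w" and t: "t \<in> {s..T}" for s t u0
  proof -
    have st: "0 \<le> s" "t \<in> {s..T}" using s t by auto
    \<comment> \<open>By (A3) the row with entries \<open>n\<close> is dominated by
      \<open>w\<close>, so the first moment is a bounded functional and passes through the matrix
      with \<open>C = 1\<close>.\<close>
    have "first_moment (matrix_op (V t s) u0)
        = (\<Sum>\<^sub>\<infinity>j\<in>{1..}. complex_of_real (\<Sum>n=1..j. real n * V t s n j) * u0 j)"
      using infsum_weighted_matrix_op[OF column_bounded_V[OF st] in_ell1[OF u0], of real 1] A3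
      by (simp add: first_moment_def)
    also have "\<dots> = (\<Sum>\<^sub>\<infinity>j\<in>{1..}. complex_of_real (real j) * u0 j)"
      using V_first_moment[OF that(1,2) st] by (intro infsum_cong) simp
    finally show ?thesis by (simp add: first_moment_def)
  qed
  show ?thesis
  proof (intro exI[of _ "\<lambda>t s. matrix_op (V t s)"] conjI ballI allI impI)
    show "evolution_family w T (\<lambda>t s. matrix_op (V t s))" by (rule evolution_family_matrix_op_V)
  next
    fix s u0 assume "s \<in> {0..<T}" "u0 \<in> ell1 w"
    then show "classical_solution w T (A_dom w a) (G_op a b) s u0 (\<lambda>t. matrix_op (V t s) u0)"
      by (intro classical_solution_matrix_op_V) auto
  next
    fix s u0 v t assume "s \<in> {0..<T}" "u0 \<in> ell1 w"
      "classical_solution w T (A_dom w a) (G_op a b) s u0 v" "t \<in> {s..T}"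
    then show "v t = matrix_op (V t s) u0"
      by (intro classical_solution_unique[OF _ _ classical_solution_matrix_op_V]) auto
  qed (use cone moment in blast)+
qed

end
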